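(* Let $\alpha\in(0,2)$, let $Z$ be the standard isotropic $\alpha$-stable process in $\mathbb{C}$ with $Z_0=1$, and let $\theta$ be its winding process around $0$. Then for any non-decreasing function $f>0$, $$\limsup_{t\to0^+}\frac{\theta_t}{f(t)}=0\ \text{ a.s.}\iff\int_0^1 (f(t))^{-\alpha}\,dt<\infty,$$ and $$\limsup_{t\to0^+}\frac{\theta_t}{f(t)}=\infty\ \text{ a.s.}\iff\int_0^1 (f(t))^{-\alpha}\,dt=\infty .$$
   Context: $Z=(Z_t,t\ge0)$ is the standard isotropic stable process of index $\alpha\in(0,2)$ in $\mathbb{C}\cong\mathbb{R}^2$ starting from $1$: it has stationary independent increments, cadlag paths, and $E[\exp(i\langle\lambda,Z_t-Z_0\rangle)]=\exp(-t|\lambda|^\alpha)$ for all $t\ge0$, $\lambda\in\mathbb{C}$, with $\langle\cdot,\cdot\rangle$ the Euclidean inner product. Almost surely $Z$ never visits $0$, $|Z_t|\to\infty$, and no jump segment of $Z$ contains $0$. Winding process $\theta=(\theta_t,t\ge0)$: on $[0,t]$, complete the path of $Z$ into a continuous curve in $\mathbb{C}\setminus\{0\}$ starting at $1$ by filling in each jump with the line segment $[Z_{s-},Z_s]$; $\theta_t$ is the total variation of the continuous determination of the argument along this curve (signed total angle wound around $0$). Equivalently, $\theta$ is the cadlag process with $\theta_0=0$, $\exp(i\theta_t)=Z_t/|Z_t|$ for all $t$, and all jumps of absolute value less than $\pi$. The function $f$ is defined on $(0,\infty)$. *)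

theory Defs
  imports "HOL-Probability.Probability"
begin

text \<open>Processes are indexed by \<^typ>\<open>real\<close>; only times \<open>t \<ge> 0\<close> are ever constrained.\<close>

definition cadlag :: "(real \<Rightarrow> 'b::t2_space) \<Rightarrow> bool" where
  "cadlag x \<longleftrightarrow>
     (\<forall>t\<ge>0. continuous (at_right t) x) \<and> (\<forall>t>0. \<exists>l. (x \<longlongrightarrow> l) (at_left t))"

locale isotropic_stable_process = prob_space M
  for M :: "'a measure" +
  fixes \<alpha> :: real and Z :: "real \<Rightarrow> 'a \<Rightarrow> complex"
  assumes random_variable_Z: "\<And>t. t \<ge> 0 \<Longrightarrow> random_variable borel (Z t)"
    and start: "AE \<omega> in M. Z 0 \<omega> = 1"
    and cadlag_paths: "AE \<omega> in M. cadlag (\<lambda>t. Z t \<omega>)"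
    and stationary_increments: "\<And>s t. s \<ge> 0 \<Longrightarrow> t \<ge> 0 \<Longrightarrow>
      distr M borel (\<lambda>\<omega>. Z (s + t) \<omega> - Z s \<omega>) = distr M borel (\<lambda>\<omega>. Z t \<omega> - Z 0 \<omega>)"
    and independent_increments: "\<And>(n::nat) (t :: nat \<Rightarrow> real).
      t 0 \<ge> 0 \<Longrightarrow> (\<And>k. k < n \<Longrightarrow> t k \<le> t (Suc k)) \<Longrightarrow>
      indep_vars (\<lambda>_. borel) (\<lambda>k \<omega>. Z (t (Suc k)) \<omega> - Z (t k) \<omega>) {..<n}"
    and characteristic_function: "\<And>t u. t \<ge> 0 \<Longrightarrow>
      expectation (\<lambda>\<omega>. iexp (u \<bullet> (Z t \<omega> - Z 0 \<omega>)))
        = complex_of_real (exp (- t * norm u powr \<alpha>))"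

text \<open>
  The winding angle of a path \<open>z\<close> with \<open>z 0 = 1\<close>, completed by a line segment at each jump, is
  the unique cadlag determination \<open>\<theta>\<close> of its argument started at \<open>0\<close> whose jumps all have absolute
  value less than \<open>\<pi>\<close>. Since \<open>0 / norm 0 = 0\<close> is not a value of \<^const>\<open>iexp\<close>, the third conjunct
  forces \<open>z\<close> to avoid \<open>0\<close>.
\<close>

definition winding_of :: "(real \<Rightarrow> complex) \<Rightarrow> (real \<Rightarrow> real) \<Rightarrow> bool" where
  "winding_of z \<theta> \<longleftrightarrow>
     cadlag \<theta> \<and>
     \<theta> 0 = 0 \<and>
     (\<forall>t\<ge>0. iexp (\<theta> t) = z t / complex_of_real (norm (z t))) \<and>
     (\<forall>t>0. \<forall>l. (\<theta> \<longlongrightarrow> l) (at_left t) \<longrightarrow> \<bar>\<theta> t - l\<bar> < pi)"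

end

theory Submission
  imports Defs
begin

text \<open>
  Near time \<open>0\<close> the path stays close to \<open>1\<close>, where the argument is comparable to the imaginary
  part: \<open>\<theta>\<close> is right continuous at \<open>0\<close> with value \<open>0\<close>, so \<open>sin (\<theta> t) = Im (Z t) / norm (Z t)\<close> pins
  \<open>\<theta> t\<close> between constant multiples of \<open>Y t = Im (Z t - Z 0)\<close> (\<open>winding_near_start\<close>). What remains
  is a Khintchine-type dichotomy for \<open>Y\<close>, a real symmetric \<open>\<alpha>\<close>-stable process with independent
  increments.

  The order of the tails is \<open>P(Y t > x) \<approx> min 1 (t * x powr - \<alpha>)\<close>. Both bounds are read off the
  characteristic function. The upper one averages \<open>1 - cos (v * Y t)\<close> over \<open>v\<close>
  (\<open>stable_tail_upper\<close>). The lower one compares two frequencies: since \<open>\<alpha> < 2\<close>, the expectation of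
  \<open>1 - cos (u * Y t)\<close> is larger for small \<open>u\<close> than values of \<open>\<bar>Y t\<bar>\<close> below the threshold could
  account for (\<open>stable_tail_lower\<close>).

  By monotonicity of \<open>f\<close>, the integral is finite iff \<open>\<Sum>n. (1/2)^n * f ((1/2)^n) powr - \<alpha>\<close>
  converges (\<open>integral_test_halving\<close>), and by the tail bounds this happens exactly when the
  probabilities that \<open>Y\<close> exceeds a fixed multiple of \<open>f\<close> at time \<open>(1/2)^n\<close> are summable.

  If it converges, Ottaviani's inequality turns the tail bound at a single time into one for the
  supremum over an interval, and the first Borel--Cantelli lemma shows that \<open>\<bar>Y\<bar>\<close> is eventually
  below every multiple of \<open>f\<close> (\<open>Y_eventually_below\<close>).

  If it diverges, the independent increments \<open>D n\<close> between the times \<open>(1/2)^Suc n\<close> and \<open>(1/2)^n\<close>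
  exceed any multiple of \<open>f ((1/2)^n)\<close> infinitely often. To conclude the same for \<open>Y\<close> itself, with
  the right sign, one needs \<open>Y ((1/2)^Suc n) \<ge> 0\<close> at the same time. This has probability at least
  \<open>1/2\<close> by symmetry and is independent of the increments that come later in time, so infinitely
  many exceedances have positive probability. Since \<open>Y ((1/2)^n)\<close> is the sum of the \<open>D k\<close> with
  \<open>k \<ge> n\<close>, they form a tail event, and Kolmogorov's zero-one law raises the probability to \<open>1\<close>
  (\<open>tail_sum_exceeds_infinitely_often\<close>, \<open>Y_infinitely_often_above\<close>).
\<close>

section \<open>Estimates for the cosine\<close>

lemma one_minus_cos_ge:
  fixes z :: real assumes "\<bar>z\<bar> \<le> 1" shows "z\<^sup>2 / 4 \<le> 1 - cos z"
proof -
  define y where "y = \<bar>z\<bar> / 2"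
  have y: "0 \<le> y" "y \<le> 1/2" using assms by (auto simp: y_def)
  have "\<bar>sin y - y\<bar> \<le> inverse 6 * \<bar>y\<bar> ^ 3"
    using Maclaurin_sin_bound[of y 3] by (simp add: eval_nat_numeral sin_coeff_def)
  moreover have "y^3 \<le> y * 1"
    using y by (simp only: power3_eq_cube mult.assoc) (intro mult_left_mono mult_le_one, auto)
  ultimately have "3/4 * y \<le> sin y" using y by (simp add: abs_if split: if_splits)
  hence "(3/4 * y)\<^sup>2 \<le> (sin y)\<^sup>2" using y by (intro power_mono) auto
  hence "9/16 * y\<^sup>2 \<le> (sin y)\<^sup>2" by (simp add: power_mult_distrib power_divide)
  moreover have "cos z = 1 - 2 * (sin y)\<^sup>2"
    using cos_double_sin[of y] by (simp add: y_def)
  moreover have "z\<^sup>2 = 4 * y\<^sup>2" by (simp add: y_def power_divide)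
  moreover have "0 \<le> (sin y)\<^sup>2" by simp
  ultimately show ?thesis by linarith
qed

lemma one_minus_cos_le:
  fixes z :: real shows "1 - cos z \<le> z\<^sup>2 / 2"
proof -
  have "cos z = 1 - 2 * (sin (z/2))\<^sup>2"
    using cos_double_sin[of "z/2"] by simp
  moreover have "(sin (z/2))\<^sup>2 \<le> (z/2)\<^sup>2"
    using abs_sin_x_le_abs_x[of "z/2"] by (simp only: abs_le_square_iff)
  ultimately show ?thesis by (simp add: power_divide)
qed

text \<open>
  Single values of \<open>1 - cos (v * z)\<close> can be arbitrarily small for large \<open>z\<close>, but the average over
  \<open>v \<in> {0..1}\<close> is \<open>1 - sin z / z\<close>. This is why the upper tail bound averages over frequencies.
\<close>

lemma nn_integral_one_minus_cos:
  fixes z :: real assumes "2 \<le> \<bar>z\<bar>"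
  shows "ennreal (1/2) \<le> (\<integral>\<^sup>+ v. ennreal (1 - cos (v * z)) * indicator {0..1} v \<partial>lborel)"
proof -
  have "z \<noteq> 0" using assms by auto
  have "(\<integral>\<^sup>+ v. ennreal (1 - cos (v * z)) * indicator {0..1} v \<partial>lborel)
      = ennreal ((1 - sin (1 * z) / z) - (0 - sin (0 * z) / z))"
    using \<open>z \<noteq> 0\<close>
    by (intro nn_integral_FTC_Icc) (auto intro!: derivative_eq_intros)
  moreover have "\<bar>sin z / z\<bar> \<le> 1 / 2"
    using assms abs_sin_le_one[of z] unfolding abs_divide by (intro frac_le) auto
  hence "1 / 2 \<le> 1 - sin z / z" by linarith
  hence "ennreal (1 / 2) \<le> ennreal (1 - sin z / z)" by (rule ennreal_leI)
  ultimately show ?thesis by simp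
qed

section \<open>Tails of symmetric stable random variables\<close>

context prob_space
begin

context
  fixes X :: "'a \<Rightarrow> real" and t \<alpha> :: real
  assumes X[measurable]: "random_variable borel X"
    and \<alpha>: "0 < \<alpha>" "\<alpha> < 2" and t: "0 \<le> t"
    and cf: "\<And>v. expectation (\<lambda>\<omega>. iexp (v * X \<omega>)) = complex_of_real (exp (- t * \<bar>v\<bar> powr \<alpha>))"
begin

lemma expectation_one_minus_cos:
  "expectation (\<lambda>\<omega>. 1 - cos (v * X \<omega>)) = 1 - exp (- t * \<bar>v\<bar> powr \<alpha>)"
proof -
  have int: "integrable M (\<lambda>\<omega>. iexp (v * X \<omega>))"
    by (intro integrable_iexp) auto
  have "expectation (\<lambda>\<omega>. cos (v * X \<omega>)) = expectation (\<lambda>\<omega>. Re (iexp (v * X \<omega>)))"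
    by (simp add: Re_exp)
  also have "\<dots> = Re (expectation (\<lambda>\<omega>. iexp (v * X \<omega>)))"
    using int by (rule integral_Re)
  finally have "expectation (\<lambda>\<omega>. cos (v * X \<omega>)) = exp (- t * \<bar>v\<bar> powr \<alpha>)"
    by (simp only: cf Re_complex_of_real)
  moreover have "integrable M (\<lambda>\<omega>. cos (v * X \<omega>))"
    by (intro integrable_const_bound[where B = 1]) auto
  ultimately show ?thesis by (simp add: prob_space)
qed

text \<open>
  \<open>X\<close> and \<open>- X\<close> have the same characteristic function because that of \<open>X\<close> is even.
\<close>

lemma stable_symmetric: "prob {\<omega>\<in>space M. X \<omega> \<in> A} = prob {\<omega>\<in>space M. - X \<omega> \<in> A}"
  if [measurable]: "A \<in> sets borel"
proof -
  have "distr M borel X = distr M borel (\<lambda>\<omega>. - X \<omega>)"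
  proof (rule Levy_uniqueness)
    show "real_distribution (distr M borel X)" "real_distribution (distr M borel (\<lambda>\<omega>. - X \<omega>))"
      by (auto intro!: real_distribution_distr)
    show "char (distr M borel X) = char (distr M borel (\<lambda>\<omega>. - X \<omega>))"
    proof
      fix v
      have "char (distr M borel (\<lambda>\<omega>. - X \<omega>)) v = expectation (\<lambda>\<omega>. iexp ((- v) * X \<omega>))"
        by (simp add: char_def integral_distr)
      also have "\<dots> = expectation (\<lambda>\<omega>. iexp (v * X \<omega>))"
        unfolding cf by simp
      finally show "char (distr M borel X) v = char (distr M borel (\<lambda>\<omega>. - X \<omega>)) v"
        by (simp add: char_def integral_distr)
    qed
  qed
  hence "measure (distr M borel X) A = measure (distr M borel (\<lambda>\<omega>. - X \<omega>)) A" by simp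
  thus ?thesis by (simp add: measure_distr vimage_def Int_def conj_commute)
qed

lemma stable_nonneg_prob: "1 / 2 \<le> prob {\<omega>\<in>space M. 0 \<le> X \<omega>}"
proof -
  have "1 \<le> prob ({\<omega>\<in>space M. 0 \<le> X \<omega>} \<union> {\<omega>\<in>space M. X \<omega> \<le> 0})"
    by (subst prob_space[symmetric], rule finite_measure_mono) auto
  also have "\<dots> \<le> prob {\<omega>\<in>space M. 0 \<le> X \<omega>} + prob {\<omega>\<in>space M. X \<omega> \<le> 0}"
    by (intro measure_Un_le) auto
  finally show ?thesis using stable_symmetric[of "{0..}"] by simp
qed

text \<open>
  With \<open>s = 2 / x\<close>, the event \<open>x \<le> \<bar>X\<bar>\<close> forces \<open>1 - cos (v * s * X)\<close> to have average at least
  \<open>1/2\<close> over \<open>v \<in> {0..1}\<close>, while its expectation \<open>1 - exp (- t * (v * s) powr \<alpha>)\<close> is at most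
  \<open>t * s powr \<alpha>\<close>.
\<close>

lemma stable_tail_upper:
  assumes "0 < x"
  shows "prob {\<omega>\<in>space M. x \<le> \<bar>X \<omega>\<bar>} \<le> 8 * (t * x powr - \<alpha>)"
proof -
  interpret P: pair_sigma_finite M lborel
    by (intro pair_sigma_finite.intro sigma_finite_measure_axioms sigma_finite_lborel)
  define s where "s = 2 / x"
  have s: "0 < s" using assms by (simp add: s_def)
  define g where "g = (\<lambda>\<omega> v. ennreal (1 - cos (v * (s * X \<omega>))) * indicator {0..1} v)"
  have [measurable]: "(\<lambda>(\<omega>, v). g \<omega> v) \<in> borel_measurable (M \<Otimes>\<^sub>M lborel)"
    unfolding g_def by measurable
  have "ennreal (1/2) * ennreal (prob {\<omega>\<in>space M. x \<le> \<bar>X \<omega>\<bar>})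
      = (\<integral>\<^sup>+\<omega>. ennreal (1/2) * indicator {\<omega>\<in>space M. x \<le> \<bar>X \<omega>\<bar>} \<omega> \<partial>M)"
    by (subst nn_integral_cmult_indicator) (auto simp: emeasure_eq_measure)
  also have "\<dots> \<le> (\<integral>\<^sup>+\<omega>. (\<integral>\<^sup>+ v. g \<omega> v \<partial>lborel) \<partial>M)"
  proof (rule nn_integral_mono)
    fix \<omega> assume "\<omega> \<in> space M"
    show "ennreal (1/2) * indicator {\<omega>\<in>space M. x \<le> \<bar>X \<omega>\<bar>} \<omega> \<le> (\<integral>\<^sup>+ v. g \<omega> v \<partial>lborel)"
    proof (cases "x \<le> \<bar>X \<omega>\<bar>")
      case True
      hence "2 \<le> \<bar>s * X \<omega>\<bar>" using assms by (simp add: s_def abs_mult field_simps)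
      from nn_integral_one_minus_cos[OF this] show ?thesis
        by (auto simp: g_def indicator_def)
    qed (auto simp: indicator_def)
  qed
  also have "\<dots> = (\<integral>\<^sup>+ v. (\<integral>\<^sup>+\<omega>. g \<omega> v \<partial>M) \<partial>lborel)"
    using P.Fubini[of "\<lambda>(\<omega>, v). g \<omega> v"] by simp
  also have "\<dots> \<le> (\<integral>\<^sup>+ v. ennreal (t * s powr \<alpha>) * indicator {0..1::real} v \<partial>lborel)"
  proof (rule nn_integral_mono)
    fix v :: real
    show "(\<integral>\<^sup>+\<omega>. g \<omega> v \<partial>M) \<le> ennreal (t * s powr \<alpha>) * indicator {0..1} v"
    proof (cases "v \<in> {0..1}")
      case True
      have "(\<integral>\<^sup>+\<omega>. g \<omega> v \<partial>M) = (\<integral>\<^sup>+\<omega>. ennreal (1 - cos ((v * s) * X \<omega>)) \<partial>M)"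
        using True by (simp add: g_def mult.assoc)
      also have "\<dots> = ennreal (expectation (\<lambda>\<omega>. 1 - cos ((v * s) * X \<omega>)))"
      proof (rule nn_integral_eq_integral)
        show "integrable M (\<lambda>\<omega>. 1 - cos ((v * s) * X \<omega>))"
          by (intro Bochner_Integration.integrable_diff integrable_const
              integrable_const_bound[where B = 1]) auto
      qed auto
      also have "\<dots> \<le> ennreal (t * s powr \<alpha>)"
      proof (rule ennreal_leI)
        have "(v * s) powr \<alpha> \<le> s powr \<alpha>"
          using True s \<alpha> by (intro powr_mono2) (auto simp: mult_left_le_one_le)
        hence "t * (v * s) powr \<alpha> \<le> t * s powr \<alpha>" using t by (rule mult_left_mono)
        moreover have "1 - t * (v * s) powr \<alpha> \<le> exp (- t * (v * s) powr \<alpha>)"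
          using exp_ge_add_one_self[of "- t * (v * s) powr \<alpha>"] by simp
        moreover have "\<bar>v * s\<bar> = v * s" using True s by simp
        ultimately show "expectation (\<lambda>\<omega>. 1 - cos ((v * s) * X \<omega>)) \<le> t * s powr \<alpha>"
          unfolding expectation_one_minus_cos by simp
      qed
      finally show ?thesis using True by simp
    qed (simp add: g_def)
  qed
  also have "\<dots> = ennreal (t * s powr \<alpha>)"
    by (subst nn_integral_cmult_indicator) auto
  finally have "1/2 * prob {\<omega>\<in>space M. x \<le> \<bar>X \<omega>\<bar>} \<le> t * s powr \<alpha>"
    using t by (simp add: ennreal_mult[symmetric] del: ennreal_half)
  moreover have "s powr \<alpha> \<le> 4 * x powr - \<alpha>"
  proof -
    have "s powr \<alpha> = 2 powr \<alpha> * x powr - \<alpha>"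
      using assms by (simp add: s_def powr_divide powr_minus field_simps)
    moreover have "(2::real) powr \<alpha> \<le> 2 powr 2" using \<alpha> by (intro powr_mono) auto
    ultimately show ?thesis by (simp add: mult_right_mono)
  qed
  hence "t * s powr \<alpha> \<le> t * (4 * x powr - \<alpha>)" using t by (rule mult_left_mono)
  ultimately show ?thesis by simp
qed

text \<open>
  Compare the frequencies \<open>w = 1 / x\<close> and \<open>u = w / l\<close>. On \<open>\<bar>X\<bar> \<le> x\<close> the quadratic behaviour of the
  cosine gives \<open>1 - cos (u * X) \<le> 2 / l\<^sup>2 * (1 - cos (w * X))\<close>, whose expectation is at most
  \<open>2 * l powr \<alpha> / l\<^sup>2\<close> times \<open>t * u powr \<alpha>\<close>. As \<open>\<alpha> < 2\<close>, a large \<open>l\<close> makes this a quarter of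
  \<open>t * u powr \<alpha>\<close>, whereas \<open>1 - cos (u * X)\<close> has expectation at least half of it. The event
  \<open>x < \<bar>X\<bar>\<close> must supply the difference.
\<close>

lemma stable_tail_lower_small:
  assumes "0 < x" and small: "t * x powr - \<alpha> \<le> 1"
  shows "8 powr (- \<alpha> / (2 - \<alpha>)) / 8 * (t * x powr - \<alpha>) \<le> prob {\<omega>\<in>space M. x < \<bar>X \<omega>\<bar>}"
proof -
  \<comment> \<open>The ratio of the frequencies solves \<open>2 * l powr \<alpha> / l\<^sup>2 = 1 / 4\<close>.\<close>
  define l where "l = 8 powr (1 / (2 - \<alpha>))"
  have l1: "1 \<le> l" using \<alpha> by (auto simp: l_def ge_one_powr_ge_zero)
  have l2: "l powr \<alpha> / l\<^sup>2 = 1 / 8"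
  proof -
    have "l powr (2 - \<alpha>) = 8" using \<alpha> by (simp add: l_def powr_powr)
    thus ?thesis using l1 by (simp add: powr_diff field_simps)
  qed
  have l3: "8 powr (- \<alpha> / (2 - \<alpha>)) = l powr - \<alpha>"
    by (simp add: l_def powr_powr)
  define w where "w = 1 / x"
  define u where "u = w / l"
  have pos: "0 < w" "0 < u" "u \<le> w"
    using assms l1 by (auto simp: w_def u_def divide_le_eq)
  have wl: "w powr \<alpha> = l powr \<alpha> * u powr \<alpha>" "w powr \<alpha> = x powr - \<alpha>"
    using pos l1 assms by (simp_all add: u_def powr_divide, simp add: w_def powr_divide powr_minus_divide)
  define y where "y = t * u powr \<alpha>"
  have y: "0 \<le> y" "y \<le> 1" "t * x powr - \<alpha> = l powr \<alpha> * y"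
  proof -
    show "0 \<le> y" using t by (simp add: y_def)
    show e: "t * x powr - \<alpha> = l powr \<alpha> * y" using wl by (simp add: y_def)
    have "1 * y \<le> l powr \<alpha> * y"
      using \<open>0 \<le> y\<close> l1 \<alpha> by (intro mult_right_mono ge_one_powr_ge_zero) auto
    thus "y \<le> 1" using small e by simp
  qed
  let ?A = "{\<omega>\<in>space M. x < \<bar>X \<omega>\<bar>}"
  have int: "integrable M (\<lambda>\<omega>. 1 - cos (v * X \<omega>))" for v
    by (intro Bochner_Integration.integrable_diff integrable_const
        integrable_const_bound[where B = 1]) auto
  have iA: "integrable M (\<lambda>\<omega>. indicator ?A \<omega> :: real)"
    by (intro integrable_real_indicator) (auto simp: emeasure_eq_measure)
  have "y / 2 \<le> 1 - exp (- y)"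
  proof -
    have "exp (- y) \<le> 1 / (1 + y)"
      using exp_ge_add_one_self[of y] y by (simp add: exp_minus field_simps)
    moreover have "1 / (1 + y) \<le> 1 - y / 2" using y by (simp add: field_simps)
      (metis mult_left_le power2_eq_square)
    ultimately show ?thesis by simp
  qed
  also have "1 - exp (- y) = expectation (\<lambda>\<omega>. 1 - cos (u * X \<omega>))"
    unfolding expectation_one_minus_cos using pos by (simp add: y_def)
  also have "\<dots> \<le> expectation (\<lambda>\<omega>. 2 / l\<^sup>2 * (1 - cos (w * X \<omega>)) + 2 * indicator ?A \<omega>)"
  proof (rule integral_mono)
    fix \<omega> assume \<omega>: "\<omega> \<in> space M"
    show "1 - cos (u * X \<omega>) \<le> 2 / l\<^sup>2 * (1 - cos (w * X \<omega>)) + 2 * indicator ?A \<omega>"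
    proof (cases "x < \<bar>X \<omega>\<bar>")
      case True
      have "0 \<le> 2 / l\<^sup>2 * (1 - cos (w * X \<omega>))" by simp
      moreover have "1 - cos (u * X \<omega>) \<le> 2" using cos_ge_minus_one[of "u * X \<omega>"] by simp
      moreover have "indicator ?A \<omega> = (1::real)" using True \<omega> by simp
      ultimately show ?thesis by linarith
    next
      case False
      hence "(w * X \<omega>)\<^sup>2 / 4 \<le> 1 - cos (w * X \<omega>)"
        using assms by (intro one_minus_cos_ge) (simp add: w_def abs_mult)
      hence "2 / l\<^sup>2 * ((w * X \<omega>)\<^sup>2 / 4) \<le> 2 / l\<^sup>2 * (1 - cos (w * X \<omega>))"
        by (rule mult_left_mono) simp
      moreover have "2 / l\<^sup>2 * ((w * X \<omega>)\<^sup>2 / 4) = (u * X \<omega>)\<^sup>2 / 2"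
        by (simp add: u_def power_mult_distrib power_divide)
      ultimately show ?thesis using one_minus_cos_le[of "u * X \<omega>"] False by simp
    qed
  qed (intro int iA Bochner_Integration.integrable_add integrable_mult_right)+
  also have "\<dots> = 2 / l\<^sup>2 * (1 - exp (- t * w powr \<alpha>)) + 2 * prob ?A"
  proof -
    have "expectation (\<lambda>\<omega>. 2 / l\<^sup>2 * (1 - cos (w * X \<omega>)) + 2 * indicator ?A \<omega>)
        = 2 / l\<^sup>2 * expectation (\<lambda>\<omega>. 1 - cos (w * X \<omega>)) + 2 * expectation (indicator ?A)"
      using int[of w] iA
      by (subst Bochner_Integration.integral_add) (intro integrable_mult_right | simp only: integral_mult_right_zero)+
    thus ?thesis using pos by (simp only: expectation_one_minus_cos) simp
  qed
  also have "\<dots> \<le> 2 / l\<^sup>2 * (l powr \<alpha> * y) + 2 * prob ?A"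
  proof -
    have "1 - exp (- t * w powr \<alpha>) \<le> l powr \<alpha> * y"
      using exp_ge_add_one_self[of "- t * w powr \<alpha>"] y(3) wl(2) by simp
    thus ?thesis by (intro add_right_mono mult_left_mono) auto
  qed
  also have "2 / l\<^sup>2 * (l powr \<alpha> * y) = y / 4"
    using l2 by (simp add: field_simps)
  finally have "y / 8 \<le> prob ?A" by simp
  moreover have "l powr - \<alpha> / 8 * (t * x powr - \<alpha>) = y / 8"
    unfolding y(3) using l1 by (simp add: powr_minus field_simps)
  ultimately show ?thesis unfolding l3 by simp
qed

text \<open>
  Where \<open>t * x powr - \<alpha>\<close> exceeds \<open>1\<close>, the threshold may be raised to \<open>t powr (1 / \<alpha>)\<close>, at which
  that quantity equals \<open>1\<close>. Symmetry then gives half of the two-sided bound to each side.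
\<close>

lemma stable_tail_lower:
  assumes "0 < x"
  shows "8 powr (- \<alpha> / (2 - \<alpha>)) / 16 * min 1 (t * x powr - \<alpha>) \<le> prob {\<omega>\<in>space M. x < X \<omega>}"
proof -
  let ?c = "8 powr (- \<alpha> / (2 - \<alpha>))"
  have "?c / 8 * min 1 (t * x powr - \<alpha>) \<le> prob {\<omega>\<in>space M. x < \<bar>X \<omega>\<bar>}"
  proof (cases "t * x powr - \<alpha> \<le> 1")
    case True
    with stable_tail_lower_small[OF assms] show ?thesis by simp
  next
    case False
    define x' where "x' = t powr (1 / \<alpha>)"
    have "0 < t" using False t by (cases "t = 0") auto
    have e: "x' powr - \<alpha> = inverse t"
      using \<open>0 < t\<close> \<alpha> by (simp add: x'_def powr_powr powr_minus)
    have "x powr \<alpha> < t" using False assms by (simp add: powr_minus field_simps)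
    hence "x \<le> x'"
      using powr_mono2[of "1 / \<alpha>" "x powr \<alpha>" t] assms \<alpha> by (simp add: x'_def powr_powr)
    have "?c / 8 * (t * x' powr - \<alpha>) \<le> prob {\<omega>\<in>space M. x' < \<bar>X \<omega>\<bar>}"
      using \<open>0 < t\<close> by (intro stable_tail_lower_small) (auto simp: e, simp add: x'_def)
    also have "\<dots> \<le> prob {\<omega>\<in>space M. x < \<bar>X \<omega>\<bar>}"
      using \<open>x \<le> x'\<close> by (intro finite_measure_mono) auto
    finally show ?thesis using False \<open>0 < t\<close> by (simp add: e)
  qed
  also have "{\<omega>\<in>space M. x < \<bar>X \<omega>\<bar>} = {\<omega>\<in>space M. X \<omega> \<in> {x<..}} \<union> {\<omega>\<in>space M. - X \<omega> \<in> {x<..}}"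
    by auto
  also have "prob \<dots> \<le> prob {\<omega>\<in>space M. X \<omega> \<in> {x<..}} + prob {\<omega>\<in>space M. - X \<omega> \<in> {x<..}}"
    by (intro measure_Un_le) auto
  also have "\<dots> = 2 * prob {\<omega>\<in>space M. x < X \<omega>}"
    using stable_symmetric[of "{x<..}"] by simp
  finally show ?thesis by simp
qed

end
end

section \<open>Sums of independent random variables\<close>

context prob_space
begin

lemma indep_vars_prob_conj:
  fixes X :: "'i \<Rightarrow> 'a \<Rightarrow> real"
  assumes ind: "indep_vars (\<lambda>_. borel) X I" and AB: "A \<inter> B = {}" "A \<subseteq> I" "B \<subseteq> I"
    and P: "Measurable.pred (PiM A (\<lambda>_. borel)) P" and Q: "Measurable.pred (PiM B (\<lambda>_. borel)) Q"
  shows "prob {\<omega>\<in>space M. P (\<lambda>i\<in>A. X i \<omega>) \<and> Q (\<lambda>i\<in>B. X i \<omega>)}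
       = prob {\<omega>\<in>space M. P (\<lambda>i\<in>A. X i \<omega>)} * prob {\<omega>\<in>space M. Q (\<lambda>i\<in>B. X i \<omega>)}"
proof -
  let ?A = "{g\<in>space (PiM A (\<lambda>_. borel)). P g}" and ?B = "{g\<in>space (PiM B (\<lambda>_. borel)). Q g}"
  have A: "(\<lambda>i\<in>A. X i \<omega>) \<in> space (PiM A (\<lambda>_. borel))" for \<omega>
    by (simp add: space_PiM)
  have B: "(\<lambda>i\<in>B. X i \<omega>) \<in> space (PiM B (\<lambda>_. borel))" for \<omega>
    by (simp add: space_PiM)
  have "?A \<in> sets (PiM A (\<lambda>_. borel))" "?B \<in> sets (PiM B (\<lambda>_. borel))"
    using P Q by (auto simp: pred_def)
  from indep_varD[OF indep_var_restrict[OF ind AB] this]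
  have "prob ((\<lambda>\<omega>. (\<lambda>i\<in>A. X i \<omega>, \<lambda>i\<in>B. X i \<omega>)) -` (?A \<times> ?B) \<inter> space M)
      = prob ((\<lambda>\<omega>. \<lambda>i\<in>A. X i \<omega>) -` ?A \<inter> space M) * prob ((\<lambda>\<omega>. \<lambda>i\<in>B. X i \<omega>) -` ?B \<inter> space M)" .
  moreover have "(\<lambda>\<omega>. (\<lambda>i\<in>A. X i \<omega>, \<lambda>i\<in>B. X i \<omega>)) -` (?A \<times> ?B) \<inter> space M
      = {\<omega>\<in>space M. P (\<lambda>i\<in>A. X i \<omega>) \<and> Q (\<lambda>i\<in>B. X i \<omega>)}"
    using A B by auto
  moreover have "(\<lambda>\<omega>. \<lambda>i\<in>A. X i \<omega>) -` ?A \<inter> space M = {\<omega>\<in>space M. P (\<lambda>i\<in>A. X i \<omega>)}"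
    using A by auto
  moreover have "(\<lambda>\<omega>. \<lambda>i\<in>B. X i \<omega>) -` ?B \<inter> space M = {\<omega>\<in>space M. Q (\<lambda>i\<in>B. X i \<omega>)}"
    using B by auto
  ultimately show ?thesis by simp
qed

lemma indep_vars_reindex:
  assumes f: "inj_on f I" and X: "indep_vars N X (f ` I)"
  shows "indep_vars (\<lambda>i. N (f i)) (\<lambda>i. X (f i)) I"
proof -
  have "indep_sets (\<lambda>i. F (f i)) I" if F: "indep_sets F (f ` I)" for F
    unfolding indep_sets_def
  proof (intro conjI ballI allI impI)
    show "F (f i) \<subseteq> events" if "i \<in> I" for i
      using F that by (auto simp: indep_sets_def)
    fix J A assume J: "J \<subseteq> I" "J \<noteq> {}" "finite J" and A: "A \<in> (\<Pi> i\<in>J. F (f i))"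
    define B where "B k = A (inv_into I f k)" for k
    have B: "B (f j) = A j" if "j \<in> J" for j
      using that J f by (simp add: B_def subset_eq)
    have "prob (\<Inter>k\<in>f ` J. B k) = (\<Prod>k\<in>f ` J. prob (B k))"
      using J A B by (intro indep_setsD[OF F]) auto
    also have "\<dots> = (\<Prod>j\<in>J. prob (B (f j)))"
      using f J by (subst prod.reindex) (auto intro: inj_on_subset)
    finally show "prob (\<Inter>j\<in>J. A j) = (\<Prod>j\<in>J. prob (A j))"
      using B by simp
  qed
  from this[of "\<lambda>i. {X i -` A \<inter> space M | A. A \<in> sets (N i)}"] show ?thesis
    using X by (auto simp: indep_vars_def2)
qed

text \<open>
  Decompose according to the first \<open>k\<close> at which \<open>A k\<close> happens. In applications \<open>B k\<close> has
  probability at least \<open>p\<close> and is independent of \<open>A 0, \<dots>, A k\<close>, hence of \<open>disjointed A k\<close>, but not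
  of the later events. Both Ottaviani's inequality and the divergent half of the dichotomy rest on
  this.
\<close>

lemma first_occurrence:
  fixes A B :: "nat \<Rightarrow> 'a set"
  assumes [measurable]: "\<And>k. A k \<in> events" "\<And>k. B k \<in> events"
    and le: "\<And>k. k < n \<Longrightarrow> p * prob (disjointed A k) \<le> prob (disjointed A k \<inter> B k)"
  shows "p * prob (\<Union>k<n. A k) \<le> prob (\<Union>k<n. A k \<inter> B k)"
proof -
  have m[measurable]: "disjointed A k \<in> events" for k
    by (rule subsetD[OF sets.range_disjointed_sets[of A M]]) auto
  have d: "disjoint_family_on (disjointed A) {0..<n}"
    by (rule disjoint_family_on_mono[OF _ disjoint_family_disjointed]) simp
  have "p * prob (\<Union>k\<in>{0..<n}. A k) = p * prob (\<Union>k\<in>{0..<n}. disjointed A k)"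
    by (simp add: finite_UN_disjointed_eq)
  also have "\<dots> = (\<Sum>k\<in>{0..<n}. p * prob (disjointed A k))"
    using d by (subst finite_measure_finite_Union) (auto simp: sum_distrib_left)
  also have "\<dots> \<le> (\<Sum>k\<in>{0..<n}. prob (disjointed A k \<inter> B k))"
    by (intro sum_mono le) auto
  also have "\<dots> = prob (\<Union>k\<in>{0..<n}. disjointed A k \<inter> B k)"
    using d by (intro finite_measure_finite_Union[symmetric]) (auto simp: disjoint_family_on_def)
  also have "\<dots> \<le> prob (\<Union>k\<in>{0..<n}. A k \<inter> B k)"
    using disjointed_subset[of A] by (intro finite_measure_mono) auto
  finally show ?thesis by (simp add: atLeast0LessThan)
qed

text \<open>
  Ottaviani's inequality. When a partial sum first exceeds \<open>2 * x\<close> in absolute value, the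
  remaining increments, being independent of the past, move the sum by at most \<open>x\<close> with
  probability at least \<open>p\<close>, and then the full sum still exceeds \<open>x\<close>.
\<close>

lemma ottaviani:
  fixes X :: "nat \<Rightarrow> 'a \<Rightarrow> real"
  assumes ind: "indep_vars (\<lambda>_. borel) X {..<n}"
    and p: "\<And>k. k \<le> n \<Longrightarrow> p \<le> prob {\<omega>\<in>space M. \<bar>\<Sum>i=k..<n. X i \<omega>\<bar> \<le> x}"
  shows "p * prob {\<omega>\<in>space M. \<exists>k\<le>n. 2 * x < \<bar>\<Sum>i<k. X i \<omega>\<bar>}
       \<le> prob {\<omega>\<in>space M. x < \<bar>\<Sum>i<n. X i \<omega>\<bar>}"
proof -
  have X[measurable]: "i < n \<Longrightarrow> X i \<in> borel_measurable M" for i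
    using ind by (auto simp: indep_vars_def2)
  define A where "A k = {\<omega>\<in>space M. k \<le> n \<and> 2 * x < \<bar>\<Sum>i<k. X i \<omega>\<bar>}" for k
  define B where "B k = {\<omega>\<in>space M. \<bar>\<Sum>i=k..<n. X i \<omega>\<bar> \<le> x}" for k
  have A: "A k \<in> events" for k
  proof (cases "k \<le> n")
    case True
    hence "(\<lambda>\<omega>. \<Sum>i<k. X i \<omega>) \<in> borel_measurable M" by (intro borel_measurable_sum X) auto
    thus ?thesis unfolding A_def by measurable
  qed (simp add: A_def)
  have B: "B k \<in> events" for k
  proof -
    have "(\<lambda>\<omega>. \<Sum>i=k..<n. X i \<omega>) \<in> borel_measurable M" by (intro borel_measurable_sum X) auto
    thus ?thesis unfolding B_def by measurable
  qed
  have "p * prob (\<Union>k<Suc n. A k) \<le> prob (\<Union>k<Suc n. A k \<inter> B k)"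
  proof (rule first_occurrence[OF A B])
    fix k assume "k < Suc n"
    hence k: "k \<le> n" by simp
    define P where "P = (\<lambda>g::nat \<Rightarrow> real. 2 * x < \<bar>\<Sum>i<k. g i\<bar> \<and> (\<forall>j\<in>{..<k}. \<not> 2 * x < \<bar>\<Sum>i<j. g i\<bar>))"
    define Q where "Q = (\<lambda>g::nat \<Rightarrow> real. \<bar>\<Sum>i=k..<n. g i\<bar> \<le> x)"
    have m: "(\<lambda>g. \<Sum>i<j. g i) \<in> borel_measurable (PiM {..<k} (\<lambda>_. borel :: real measure))" if "j \<le> k" for j
      using that by (intro borel_measurable_sum measurable_component_singleton) auto
    have [measurable]: "Measurable.pred (PiM {..<k} (\<lambda>_. borel)) P"
      unfolding P_def using m
      by (intro pred_intros_logic pred_intros_finite borel_measurable_pred_less borel_measurable_abs) auto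
    have "(\<lambda>g. \<Sum>i=k..<n. g i) \<in> borel_measurable (PiM {k..<n} (\<lambda>_. borel :: real measure))"
      by (intro borel_measurable_sum measurable_component_singleton) auto
    hence [measurable]: "Measurable.pred (PiM {k..<n} (\<lambda>_. borel)) Q"
      unfolding Q_def by measurable
    have sumA: "(\<Sum>i<j. (\<lambda>i\<in>{..<k}. X i \<omega>) i) = (\<Sum>i<j. X i \<omega>)" if "j \<le> k" for j \<omega>
      using that by (intro sum.cong) auto
    have dA: "disjointed A k = {\<omega>\<in>space M. P (\<lambda>i\<in>{..<k}. X i \<omega>)}"
      using k by (auto simp: disjointed_def A_def P_def sumA less_imp_le simp del: restrict_apply)
    have BQ: "B k = {\<omega>\<in>space M. Q (\<lambda>i\<in>{k..<n}. X i \<omega>)}"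
      by (auto simp: B_def Q_def)
    have "prob (disjointed A k) * prob (B k) = prob (disjointed A k \<inter> B k)"
      unfolding dA BQ using k
      by (subst indep_vars_prob_conj[OF ind, symmetric]) (auto intro!: arg_cong[where f = prob])
    moreover have "p * prob (disjointed A k) \<le> prob (B k) * prob (disjointed A k)"
      using p[OF k] by (intro mult_right_mono) (auto simp: B_def)
    ultimately show "p * prob (disjointed A k) \<le> prob (disjointed A k \<inter> B k)"
      by (simp add: mult.commute)
  qed
  also have "(\<Union>k<Suc n. A k) = {\<omega>\<in>space M. \<exists>k\<le>n. 2 * x < \<bar>\<Sum>i<k. X i \<omega>\<bar>}"
    by (auto simp: A_def less_Suc_eq_le)
  also have "prob (\<Union>k<Suc n. A k \<inter> B k) \<le> prob {\<omega>\<in>space M. x < \<bar>\<Sum>i<n. X i \<omega>\<bar>}"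
  proof (rule finite_measure_mono)
    show "(\<Union>k<Suc n. A k \<inter> B k) \<subseteq> {\<omega>\<in>space M. x < \<bar>\<Sum>i<n. X i \<omega>\<bar>}"
    proof (safe)
      fix k \<omega> assume *: "\<omega> \<in> A k" "\<omega> \<in> B k"
      hence "k \<le> n" and "\<omega> \<in> space M" by (auto simp: A_def)
      hence "(\<Sum>i<n. X i \<omega>) = (\<Sum>i<k. X i \<omega>) + (\<Sum>i=k..<n. X i \<omega>)"
        by (metis atLeast0LessThan sum.atLeastLessThan_concat zero_le)
      thus "x < \<bar>\<Sum>i<n. X i \<omega>\<bar>" "\<omega> \<in> space M" using * by (auto simp: A_def B_def)
    qed
    have "(\<lambda>\<omega>. \<Sum>i<n. X i \<omega>) \<in> borel_measurable M" by (intro borel_measurable_sum X) auto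
    thus "{\<omega>\<in>space M. x < \<bar>\<Sum>i<n. X i \<omega>\<bar>} \<in> events" by measurable
  qed
  finally show ?thesis .
qed

text \<open>
  A quantitative form of the second Borel--Cantelli lemma, from \<open>1 - q \<le> exp (- q)\<close>.
\<close>

lemma indep_vars_prob_exceeds:
  fixes X :: "nat \<Rightarrow> 'a \<Rightarrow> real"
  assumes ind: "indep_vars (\<lambda>_. borel) X UNIV" and J: "finite J"
  shows "1 - exp (- (\<Sum>n\<in>J. prob {\<omega>\<in>space M. a n < X n \<omega>}))
       \<le> prob {\<omega>\<in>space M. \<exists>n\<in>J. a n < X n \<omega>}"
proof (cases "J = {}")
  case False
  have X[measurable]: "X i \<in> borel_measurable M" for i
    using ind by (auto simp: indep_vars_def2)
  have le: "prob {\<omega>\<in>space M. X n \<omega> \<le> a n} = 1 - prob {\<omega>\<in>space M. a n < X n \<omega>}" for n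
    using prob_neg[of "\<lambda>\<omega>. a n < X n \<omega>"] by (simp add: not_less)
  have "1 - prob {\<omega>\<in>space M. \<exists>n\<in>J. a n < X n \<omega>} = prob {\<omega>\<in>space M. \<forall>n\<in>J. X n \<omega> \<le> a n}"
    using J prob_neg[of "\<lambda>\<omega>. \<exists>n\<in>J. a n < X n \<omega>"] by (simp add: not_less)
  also have "{\<omega>\<in>space M. \<forall>n\<in>J. X n \<omega> \<le> a n} = (\<Inter>n\<in>J. X n -` {..a n} \<inter> space M)"
    using False by auto
  also have "prob \<dots> = (\<Prod>n\<in>J. prob (X n -` {..a n} \<inter> space M))"
    using indep_varsD[OF ind False J, of "\<lambda>n. {..a n}"] by simp
  also have "\<dots> = (\<Prod>n\<in>J. 1 - prob {\<omega>\<in>space M. a n < X n \<omega>})"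
    unfolding le[symmetric] by (intro prod.cong arg_cong[where f = prob]) auto
  also have "\<dots> \<le> (\<Prod>n\<in>J. exp (- prob {\<omega>\<in>space M. a n < X n \<omega>}))"
    using exp_ge_add_one_self[of "- prob {\<omega>\<in>space M. a _ < X _ \<omega>}"]
    by (intro prod_mono) auto
  also have "\<dots> = exp (- (\<Sum>n\<in>J. prob {\<omega>\<in>space M. a n < X n \<omega>}))"
    using J by (simp add: exp_sum sum_negf[symmetric])
  finally show ?thesis by simp
qed simp

text \<open>
  If \<open>a n < D n\<close> and the next tail sum \<open>T (Suc n)\<close> is nonnegative, then \<open>a n < T n\<close>. Since
  \<open>T (Suc n)\<close> is independent of \<open>D 0, \<dots>, D n\<close>, \<open>first_occurrence\<close> shows that beyond any index some
  \<open>n\<close> satisfies \<open>a n < T n\<close> with probability at least \<open>p\<close>; hence so do infinitely many. That event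
  does not change when finitely many of the \<open>D n\<close> do, so its probability is \<open>0\<close> or \<open>1\<close>.
\<close>

lemma tail_sum_exceeds_infinitely_often:
  fixes D :: "nat \<Rightarrow> 'a \<Rightarrow> real" and a :: "nat \<Rightarrow> real"
  defines "T \<equiv> \<lambda>n \<omega>. \<Sum>k. D (k + n) \<omega>"
  assumes ind: "indep_vars (\<lambda>_. borel) D UNIV"
    and conv: "AE \<omega> in M. summable (\<lambda>n. D n \<omega>)"
    and "0 < p" and p: "\<And>n. p \<le> prob {\<omega>\<in>space M. 0 \<le> T n \<omega>}"
    and div: "\<not> summable (\<lambda>n. prob {\<omega>\<in>space M. a n < D n \<omega>})"
  shows "AE \<omega> in M. \<forall>N. \<exists>n\<ge>N. a n < T n \<omega>"
proof -
  have D[measurable]: "D i \<in> borel_measurable M" for i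
    using ind by (auto simp: indep_vars_def2)
  have T[measurable]: "T n \<in> borel_measurable M" for n
    unfolding T_def by measurable
  define E where "E N = {\<omega>\<in>space M. \<exists>n\<ge>N. a n < T n \<omega>}" for N
  have E[measurable]: "E N \<in> events" for N unfolding E_def by measurable
  have step: "AE \<omega> in M. \<forall>n. T n \<omega> = D n \<omega> + T (Suc n) \<omega>"
    using conv
  proof eventually_elim
    case (elim \<omega>)
    show ?case
    proof
      fix n
      have "summable (\<lambda>k. D (k + n) \<omega>)" using elim by (rule summable_ignore_initial_segment)
      from suminf_split_head[OF this] show "T n \<omega> = D n \<omega> + T (Suc n) \<omega>"
        by (simp add: T_def)
    qed
  qed
  have finite_part: "p * prob {\<omega>\<in>space M. \<exists>n\<in>{N..<m}. a n < D n \<omega>} \<le> prob (E N)" for N m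
  proof -
    define A where "A n = {\<omega>\<in>space M. N \<le> n \<and> a n < D n \<omega>}" for n
    define B where "B n = {\<omega>\<in>space M. 0 \<le> T (Suc n) \<omega>}" for n
    have [measurable]: "A n \<in> events" "B n \<in> events" for n
      unfolding A_def B_def by measurable
    have "p * prob (\<Union>n<m. A n) \<le> prob (\<Union>n<m. A n \<inter> B n)"
    proof (rule first_occurrence)
      fix n
      define P where "P = (\<lambda>g::nat \<Rightarrow> real. N \<le> n \<and> a n < g n \<and> (\<forall>j\<in>{..<n}. \<not> (N \<le> j \<and> a j < g j)))"
      define Q where "Q = (\<lambda>g::nat \<Rightarrow> real. 0 \<le> (\<Sum>k. g (k + Suc n)))"
      have [measurable]: "Measurable.pred (PiM {..n} (\<lambda>_. borel)) P"
        unfolding P_def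
        by (intro pred_intros_logic pred_intros_finite borel_measurable_pred_less
            measurable_component_singleton) auto
      have "(\<lambda>g. \<Sum>k. g (k + Suc n)) \<in> borel_measurable (PiM {Suc n..} (\<lambda>_. borel :: real measure))"
        by (intro borel_measurable_suminf measurable_component_singleton) auto
      hence [measurable]: "Measurable.pred (PiM {Suc n..} (\<lambda>_. borel)) Q"
        unfolding Q_def by measurable
      have dA: "disjointed A n = {\<omega>\<in>space M. P (\<lambda>i\<in>{..n}. D i \<omega>)}"
        by (auto simp: disjointed_def A_def P_def)
      have BQ: "B n = {\<omega>\<in>space M. Q (\<lambda>i\<in>{Suc n..}. D i \<omega>)}"
        by (auto simp: B_def Q_def T_def)
      have "prob (disjointed A n) * prob (B n) = prob (disjointed A n \<inter> B n)"
        unfolding dA BQ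
        by (subst indep_vars_prob_conj[OF ind, symmetric]) (auto intro!: arg_cong[where f = prob])
      moreover have "p * prob (disjointed A n) \<le> prob (B n) * prob (disjointed A n)"
        using p[of "Suc n"] by (intro mult_right_mono) (auto simp: B_def)
      ultimately show "p * prob (disjointed A n) \<le> prob (disjointed A n \<inter> B n)"
        by (simp add: mult.commute)
    qed auto
    also have "(\<Union>n<m. A n) = {\<omega>\<in>space M. \<exists>n\<in>{N..<m}. a n < D n \<omega>}"
      by (auto simp: A_def)
    also have "prob (\<Union>n<m. A n \<inter> B n) \<le> prob (E N)"
    proof (rule finite_measure_mono_AE)
      show "AE \<omega> in M. \<omega> \<in> (\<Union>n<m. A n \<inter> B n) \<longrightarrow> \<omega> \<in> E N"
        using step
      proof eventually_elim
        case (elim \<omega>)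
        show ?case
        proof
          assume "\<omega> \<in> (\<Union>n<m. A n \<inter> B n)"
          then obtain n where "\<omega> \<in> A n" "\<omega> \<in> B n" by auto
          moreover from this have "a n < T n \<omega>"
            using elim[rule_format, of n] by (auto simp: A_def B_def)
          ultimately show "\<omega> \<in> E N" by (auto simp: E_def A_def)
        qed
      qed
    qed auto
    finally show ?thesis .
  qed
  have E_ge: "p \<le> prob (E N)" for N
  proof (rule field_le_epsilon)
    fix e :: real assume "0 < e"
    let ?q = "\<lambda>n. prob {\<omega>\<in>space M. a n < D n \<omega>}"
    have "\<not> (\<forall>m. (\<Sum>n<m. ?q n) \<le> (\<Sum>n<N. ?q n) - ln (e / p))"
    proof
      assume "\<forall>m. (\<Sum>n<m. ?q n) \<le> (\<Sum>n<N. ?q n) - ln (e / p)"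
      hence "summable ?q" by (intro summableI_nonneg_bounded) auto
      with div show False by simp
    qed
    then obtain m where m: "(\<Sum>n<N. ?q n) - ln (e / p) < (\<Sum>n<m. ?q n)"
      by (auto simp: not_le)
    have "(\<Sum>n<m. ?q n) \<le> (\<Sum>n\<in>{..<N} \<union> {N..<m}. ?q n)"
      by (intro sum_mono2) auto
    also have "\<dots> = (\<Sum>n<N. ?q n) + (\<Sum>n\<in>{N..<m}. ?q n)"
      by (intro sum.union_disjoint) auto
    finally have "- (\<Sum>n\<in>{N..<m}. ?q n) \<le> ln (e / p)" using m by simp
    hence "exp (- (\<Sum>n\<in>{N..<m}. ?q n)) \<le> e / p"
      using \<open>0 < e\<close> \<open>0 < p\<close> by (simp add: ln_ge_iff)
    hence "p * (1 - e / p) \<le> p * prob {\<omega>\<in>space M. \<exists>n\<in>{N..<m}. a n < D n \<omega>}"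
      using indep_vars_prob_exceeds[OF ind, of "{N..<m}" a] \<open>0 < p\<close>
      by (intro mult_left_mono) auto
    also have "\<dots> \<le> prob (E N)" by (rule finite_part)
    finally show "p \<le> prob (E N) + e" using \<open>0 < p\<close> by (simp add: algebra_simps)
  qed
  \<comment> \<open>\<open>G\<close> is the decreasing limit of the \<open>E N\<close>, so it inherits the bound \<open>p\<close>.\<close>
  define G where "G = {\<omega>\<in>space M. \<forall>N. \<exists>n\<ge>N. a n < T n \<omega>}"
  have "p \<le> prob (\<Inter>N. E N)"
  proof (rule LIMSEQ_le_const)
    show "(\<lambda>N. prob (E N)) \<longlonglongrightarrow> prob (\<Inter>N. E N)"
      by (intro finite_Lim_measure_decseq) (auto simp: decseq_def E_def intro: order_trans)
  qed (use E_ge in auto)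
  also have "(\<Inter>N. E N) = G" by (auto simp: E_def G_def)
  finally have "p \<le> prob G" .
  moreover have "prob G = 0 \<or> prob G = 1"
  proof (rule kolmogorov_0_1_law)
    let ?A = "\<lambda>i. sigma_sets (space M) {D i -` S \<inter> space M | S. S \<in> sets borel}"
    show "sigma_algebra (space M) (?A i)" for i
      by (rule sigma_algebra_sigma_sets) auto
    show "indep_sets ?A UNIV" using ind by (simp add: indep_vars_def)
    show "G \<in> tail_events ?A" unfolding tail_events_def
    proof
      fix m
      define F where "F = sigma (space M) (\<Union>i\<in>{m..}. ?A i)"
      have sub: "(\<Union>i\<in>{m..}. ?A i) \<subseteq> Pow (space M)"
        using sigma_sets_into_sp[of "{D _ -` S \<inter> space M | S. S \<in> sets borel}" "space M"] by blast
      have setsF: "sets F = sigma_sets (space M) (\<Union>i\<in>{m..}. ?A i)"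
        unfolding F_def by (rule sets_measure_of[OF sub])
      have spaceF: "space F = space M" unfolding F_def by (rule space_measure_of[OF sub])
      have [measurable]: "D i \<in> borel_measurable F" if "m \<le> i" for i
      proof (rule measurableI)
        fix S :: "real set" assume "S \<in> sets borel"
        hence "D i -` S \<inter> space M \<in> ?A i" by (intro sigma_sets.Basic) auto
        thus "D i -` S \<inter> space F \<in> sets F"
          using that unfolding setsF spaceF by (intro sigma_sets.Basic) auto
      qed auto
      have TF: "T (n + m) \<in> borel_measurable F" for n
        unfolding T_def by (intro borel_measurable_suminf) auto
      \<comment> \<open>Dropping the first \<open>m\<close> indices does not affect \<open>G\<close>, and then only \<open>D i\<close> with \<open>m \<le> i\<close> occur.\<close>
      have "G = {\<omega>\<in>space F. \<forall>N. \<exists>n\<ge>N. a (n + m) < T (n + m) \<omega>}"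
      proof -
        have "(\<forall>N. \<exists>n\<ge>N. R n) \<longleftrightarrow> (\<forall>N. \<exists>n\<ge>N. R (n + m))" for R
        proof safe
          fix N assume "\<forall>N. \<exists>n\<ge>N. R n"
          then obtain n where "N + m \<le> n" "R n" by blast
          thus "\<exists>n\<ge>N. R (n + m)" by (intro exI[of _ "n - m"]) auto
        next
          fix N assume "\<forall>N. \<exists>n\<ge>N. R (n + m)"
          then obtain n where "N \<le> n" "R (n + m)" by blast
          thus "\<exists>n\<ge>N. R n" by (intro exI[of _ "n + m"]) auto
        qed
        from this[of "\<lambda>n. a n < T n _"] show ?thesis unfolding G_def spaceF by simp
      qed
      also have "\<dots> \<in> sets F" using TF by measurable
      finally show "G \<in> sigma_sets (space M) (\<Union>i\<in>{m..}. ?A i)" by (simp only: setsF)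
    qed
  qed
  ultimately have "prob G = 1" using \<open>0 < p\<close> by auto
  hence "AE \<omega> in M. \<omega> \<in> G" by (rule AE_prob_1)
  thus ?thesis by eventually_elim (simp add: G_def)
qed

end

section \<open>Dyadic times\<close>

text \<open>
  Every \<open>s < T\<close> is the limit from the right of the grid points \<open>u m\<close> next above it. This makes the
  supremum over an interval a supremum over countably many times.
\<close>

lemma abs_bound_from_dyadics:
  fixes y :: "real \<Rightarrow> real"
  assumes rc: "continuous (at_right s) y" and s: "0 \<le> s" "s \<le> T"
    and B: "\<And>m k::nat. k \<le> 2 ^ m \<Longrightarrow> \<bar>y (real k * T / 2 ^ m)\<bar> \<le> B"
  shows "\<bar>y s\<bar> \<le> B"
proof (cases "s = T")
  case True
  thus ?thesis using B[of 1 0] by simp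
next
  case False
  with s have s: "0 \<le> s" "s < T" by auto
  define k where "k m = nat \<lfloor>2 ^ m * s / T\<rfloor> + 1" for m :: nat
  define u where "u m = real (k m) * T / 2 ^ m" for m
  have T: "0 < T" using s by simp
  have k: "2 ^ m * s / T < real (k m)" "real (k m) \<le> 2 ^ m * s / T + 1" for m
  proof -
    have "0 \<le> 2 ^ m * s / T" using s by simp
    hence "real (k m) = of_int \<lfloor>2 ^ m * s / T\<rfloor> + 1" by (simp add: k_def)
    thus "2 ^ m * s / T < real (k m)" "real (k m) \<le> 2 ^ m * s / T + 1" by linarith+
  qed
  have u: "s < u m" "u m \<le> s + T * (1 / 2) ^ m" for m
    using k[of m] T by (simp_all add: u_def field_simps power_divide)
  have "k m \<le> 2 ^ m" for m
  proof -
    have "2 ^ m * s / T < 2 ^ m" using s T by (simp add: divide_less_eq)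
    hence "real (k m) < real (2 ^ m + 1)" using k(2)[of m] by simp
    thus ?thesis by (simp only: of_nat_less_iff)
  qed
  hence bound: "\<bar>y (u m)\<bar> \<le> B" for m using B by (simp add: u_def)
  have "(\<lambda>m. s + T * (1 / 2) ^ m) \<longlonglongrightarrow> s + T * 0"
    by (intro tendsto_intros LIMSEQ_power_zero) auto
  hence "u \<longlonglongrightarrow> s"
    using u by (intro tendsto_sandwich[of "\<lambda>_. s" u sequentially "\<lambda>m. s + T * (1 / 2) ^ m"])
      (auto intro!: always_eventually less_imp_le)
  hence "filterlim u (at_right s) sequentially"
    using u(1) by (intro tendsto_imp_filterlim_at_right) (auto intro!: always_eventually)
  moreover have "(y \<longlongrightarrow> y s) (at_right s)" using rc by (simp add: continuous_within)
  ultimately have "(\<lambda>m. y (u m)) \<longlonglongrightarrow> y s" by (rule filterlim_compose[rotated])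
  hence "(\<lambda>m. \<bar>y (u m)\<bar>) \<longlonglongrightarrow> \<bar>y s\<bar>" by (rule tendsto_rabs)
  thus ?thesis using bound by (intro LIMSEQ_le_const2) auto
qed

lemma half_power_bracket:
  fixes t :: real
  assumes "0 < t" "t \<le> (1 / 2) ^ N"
  obtains n where "N \<le> n" "(1 / 2) ^ Suc n < t" "t \<le> (1 / 2) ^ n"
proof -
  define m where "m = (LEAST n. (1 / 2 :: real) ^ n < t)"
  obtain n where "(1 / 2 :: real) ^ n < t"
    using real_arch_pow_inv[of t "1 / 2"] assms by auto
  hence m: "(1 / 2 :: real) ^ m < t"
    unfolding m_def by (rule LeastI)
  have "N < m"
  proof (rule ccontr)
    assume "\<not> N < m"
    hence "(1 / 2 :: real) ^ N \<le> (1 / 2) ^ m" by (intro power_decreasing) auto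
    thus False using m assms by linarith
  qed
  then obtain n where n: "m = Suc n" by (cases m) auto
  have "\<not> (1 / 2 :: real) ^ n < t"
    using not_less_Least[of n "\<lambda>n. (1 / 2 :: real) ^ n < t"] n by (simp add: m_def)
  thus ?thesis using that[of n] m \<open>N < m\<close> n by simp
qed

lemma nn_integral_halving_intervals:
  fixes c :: "nat \<Rightarrow> real"
  assumes "\<And>n. 0 \<le> c n"
  shows "(\<integral>\<^sup>+ t. (\<Sum>n. ennreal (c n) * indicator {(1 / 2) ^ Suc n<..(1 / 2 :: real) ^ n} t) \<partial>lborel)
       = (\<Sum>n. ennreal ((1 / 2) ^ Suc n * c n))"
proof -
  have "(\<integral>\<^sup>+ t. (\<Sum>n. ennreal (c n) * indicator {(1 / 2) ^ Suc n<..(1 / 2 :: real) ^ n} t) \<partial>lborel)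
      = (\<Sum>n. \<integral>\<^sup>+ t. ennreal (c n) * indicator {(1 / 2) ^ Suc n<..(1 / 2 :: real) ^ n} t \<partial>lborel)"
    by (rule nn_integral_suminf) auto
  also have "\<dots> = (\<Sum>n. ennreal ((1 / 2) ^ Suc n * c n))"
  proof (intro suminf_cong)
    fix n
    have "(\<integral>\<^sup>+ t. ennreal (c n) * indicator {(1 / 2) ^ Suc n<..(1 / 2 :: real) ^ n} t \<partial>lborel)
        = ennreal (c n) * emeasure lborel {(1 / 2) ^ Suc n<..(1 / 2 :: real) ^ n}"
      by (rule nn_integral_cmult_indicator) auto
    also have "\<dots> = ennreal (c n) * ennreal ((1 / 2) ^ n - (1 / 2) ^ Suc n)"
      by (subst emeasure_lborel_Ioc) (auto intro!: power_decreasing)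
    also have "\<dots> = ennreal ((1 / 2) ^ Suc n * c n)"
      using assms[of n] by (simp add: ennreal_mult[symmetric] mult.commute)
    finally show "(\<integral>\<^sup>+ t. ennreal (c n) * indicator {(1 / 2) ^ Suc n<..(1 / 2 :: real) ^ n} t \<partial>lborel)
        = ennreal ((1 / 2) ^ Suc n * c n)" .
  qed
  finally show ?thesis .
qed

lemma suminf_halving_indicator:
  fixes c :: "nat \<Rightarrow> ennreal" and t :: real
  assumes "t \<in> {(1 / 2) ^ Suc m<..(1 / 2) ^ m}"
  shows "(\<Sum>n. c n * indicator {(1 / 2) ^ Suc n<..(1 / 2) ^ n} t) = c m"
proof (rule suminf_cmult_indicator[where A = "\<lambda>n. {(1 / 2) ^ Suc n<..(1 / 2) ^ n}", OF _ assms])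
  have "{(1 / 2) ^ Suc i<..(1 / 2) ^ i} \<inter> {(1 / 2) ^ Suc j<..(1 / 2 :: real) ^ j} = {}"
    if "i < j" for i j
  proof -
    have "(1 / 2 :: real) ^ j \<le> (1 / 2) ^ Suc i" using that by (intro power_decreasing) auto
    thus ?thesis by auto
  qed
  thus "disjoint_family (\<lambda>n. {(1 / 2 :: real) ^ Suc n<..(1 / 2) ^ n})"
    unfolding disjoint_family_on_def by (metis Int_commute nat_neq_iff)
qed

text \<open>
  Cauchy condensation at the origin: on \<open>{(1 / 2) ^ Suc n<..(1 / 2) ^ n}\<close> the function lies
  between its values at the endpoints, and replacing one endpoint by the other only shifts the
  series and scales it.
\<close>

lemma integral_test_halving:
  fixes g :: "real \<Rightarrow> real"
  assumes anti: "\<And>s t. 0 < s \<Longrightarrow> s \<le> t \<Longrightarrow> g t \<le> g s" and nonneg: "\<And>t. 0 < t \<Longrightarrow> 0 \<le> g t"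
  shows "(\<integral>\<^sup>+ t\<in>{0<..1}. ennreal (g t) \<partial>lborel) < \<infinity> \<longleftrightarrow> summable (\<lambda>n. (1 / 2) ^ n * g ((1 / 2) ^ n))"
    (is "?I < \<infinity> \<longleftrightarrow> summable ?q")
proof
  let ?J = "\<lambda>n. {(1 / 2) ^ Suc n<..(1 / 2 :: real) ^ n}"
  have g: "0 \<le> g ((1 / 2) ^ n)" for n using nonneg by simp
  {
    assume fin: "?I < \<infinity>"
    have "(\<Sum>n. ennreal ((1 / 2) ^ Suc n * g ((1 / 2) ^ n)))
        = (\<integral>\<^sup>+ t. (\<Sum>n. ennreal (g ((1 / 2) ^ n)) * indicator (?J n) t) \<partial>lborel)"
      using g by (intro nn_integral_halving_intervals[symmetric])
    also have "\<dots> \<le> ?I"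
    proof (rule nn_integral_mono)
      fix t :: real
      show "(\<Sum>n. ennreal (g ((1 / 2) ^ n)) * indicator (?J n) t) \<le> ennreal (g t) * indicator {0<..1} t"
      proof (cases "\<exists>m. t \<in> ?J m")
        case True
        then obtain m where m: "t \<in> ?J m" ..
        have t: "0 < t" "t \<le> 1"
        proof -
          have "0 < (1 / 2 :: real) ^ Suc m" "(1 / 2 :: real) ^ m \<le> 1" by (auto intro: power_le_one)
          thus "0 < t" "t \<le> 1" using m unfolding greaterThanAtMost_iff by linarith+
        qed
        hence "ennreal (g ((1 / 2) ^ m)) \<le> ennreal (g t)"
          using m by (intro ennreal_leI anti) auto
        thus ?thesis using t by (simp only: suminf_halving_indicator[OF m]) simp
      next
        case False
        hence "(\<lambda>n. ennreal (g ((1 / 2) ^ n)) * indicator (?J n) t) = (\<lambda>_. 0)"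
          by (auto simp: indicator_def)
        thus ?thesis by simp
      qed
    qed
    finally have "summable (\<lambda>n. (1 / 2) ^ Suc n * g ((1 / 2) ^ n))"
      using fin g by (intro summable_suminf_not_top) auto
    hence "summable (\<lambda>n. 1 / 2 * ?q n)" by (simp add: mult.assoc)
    thus "summable ?q" by (simp add: summable_cmult_iff)
  }
  {
    assume "summable ?q"
    hence s: "summable (\<lambda>n. ?q (Suc n))" by (subst summable_Suc_iff)
    have fin: "(\<Sum>n. ennreal (?q (Suc n))) \<noteq> top"
      using nonneg by (intro ennreal_suminf_neq_top[OF s] mult_nonneg_nonneg) auto
    have "?I \<le> (\<integral>\<^sup>+ t. (\<Sum>n. ennreal (g ((1 / 2) ^ Suc n)) * indicator (?J n) t) \<partial>lborel)"
    proof (rule nn_integral_mono)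
      fix t :: real
      show "ennreal (g t) * indicator {0<..1} t \<le> (\<Sum>n. ennreal (g ((1 / 2) ^ Suc n)) * indicator (?J n) t)"
      proof (cases "t \<in> {0<..1}")
        case True
        then obtain m where m: "t \<in> ?J m" using half_power_bracket[of t 0] by auto
        have "ennreal (g t) \<le> ennreal (g ((1 / 2) ^ Suc m))"
          using m by (intro ennreal_leI anti) auto
        thus ?thesis using True by (simp only: suminf_halving_indicator[OF m]) simp
      qed simp
    qed
    also have "\<dots> = (\<Sum>n. ennreal ((1 / 2) ^ Suc n * g ((1 / 2) ^ Suc n)))"
      using nonneg by (intro nn_integral_halving_intervals) simp
    also have "\<dots> < \<infinity>"
      using fin by (simp only: less_top infinity_ennreal_def)
    finally show "?I < \<infinity>" .
  }
qed

section \<open>The component of the process transversal to its starting direction\<close>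

context isotropic_stable_process
begin

text \<open>
  The process starts at \<open>1\<close>, so the imaginary direction is the one in which the argument varies to
  first order. As \<open>Z 0 = 1\<close> holds only almost surely, the starting point is subtracted to make
  \<open>Y 0 = 0\<close> hold everywhere.
\<close>

definition Y :: "real \<Rightarrow> 'a \<Rightarrow> real" where
  "Y t \<omega> = Im (Z t \<omega> - Z 0 \<omega>)"

lemma Y_0 [simp]: "Y 0 \<omega> = 0"
  by (simp add: Y_def)

lemma random_variable_Y: "0 \<le> t \<Longrightarrow> random_variable borel (Y t)"
  using random_variable_Z[of t] random_variable_Z[of 0] unfolding Y_def[abs_def] by measurable

lemma Y_increment_char:
  assumes s: "0 \<le> s" and t: "0 \<le> t"
  shows "expectation (\<lambda>\<omega>. iexp (v * (Y (s + t) \<omega> - Y s \<omega>))) = complex_of_real (exp (- t * \<bar>v\<bar> powr \<alpha>))"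
proof -
  note [measurable] = random_variable_Z[OF order_refl] random_variable_Z[OF s]
    random_variable_Z[OF t] random_variable_Z[OF add_nonneg_nonneg[OF s t]]
  have v: "Complex 0 v \<bullet> z = v * Im z" for z by (simp add: inner_complex_def)
  have "expectation (\<lambda>\<omega>. iexp (v * (Y (s + t) \<omega> - Y s \<omega>)))
      = expectation (\<lambda>\<omega>. iexp (v * Im (Z (s + t) \<omega> - Z s \<omega>)))"
    by (simp add: Y_def)
  also have "\<dots> = (\<integral>z. iexp (v * Im z) \<partial>distr M borel (\<lambda>\<omega>. Z (s + t) \<omega> - Z s \<omega>))"
    by (subst integral_distr) auto
  also have "\<dots> = (\<integral>z. iexp (v * Im z) \<partial>distr M borel (\<lambda>\<omega>. Z t \<omega> - Z 0 \<omega>))"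
    by (simp only: stationary_increments[OF s t])
  also have "\<dots> = expectation (\<lambda>\<omega>. iexp (Complex 0 v \<bullet> (Z t \<omega> - Z 0 \<omega>)))"
    by (subst integral_distr) (auto simp: v)
  also have "\<dots> = complex_of_real (exp (- t * norm (Complex 0 v) powr \<alpha>))"
    by (rule characteristic_function[OF t])
  finally show ?thesis by (simp add: complex_norm)
qed

lemma indep_vars_Y_increments:
  assumes "0 \<le> t 0" "\<And>k. k < n \<Longrightarrow> t k \<le> t (Suc k)"
  shows "indep_vars (\<lambda>_. borel) (\<lambda>k \<omega>. Y (t (Suc k)) \<omega> - Y (t k) \<omega>) {..<n}"
proof -
  have "indep_vars (\<lambda>_. borel) (\<lambda>k \<omega>. Im (Z (t (Suc k)) \<omega> - Z (t k) \<omega>)) {..<n}"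
    by (rule indep_vars_compose2[OF independent_increments[OF assms]]) auto
  thus ?thesis by (simp add: Y_def)
qed

text \<open>
  The times \<open>(1 / 2) ^ n\<close> decrease, so finitely many of these increments are the increments along
  an increasing sequence of times, numbered backwards.
\<close>

lemma indep_vars_Y_halving:
  "indep_vars (\<lambda>_. borel) (\<lambda>n \<omega>. Y ((1 / 2) ^ n) \<omega> - Y ((1 / 2) ^ Suc n) \<omega>) UNIV"
  (is "indep_vars _ ?D UNIV")
proof -
  have fin: "indep_vars (\<lambda>_. borel) ?D {..<n}" for n
  proof -
    let ?r = "\<lambda>j. n - Suc j"
    have img: "?r ` {..<n} = {..<n}"
    proof safe
      fix j assume "j < n"
      thus "j \<in> ?r ` {..<n}" by (intro image_eqI[of _ _ "n - Suc j"]) auto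
    qed auto
    have "indep_vars (\<lambda>_. borel)
        (\<lambda>k \<omega>. Y ((1 / 2) ^ (n - Suc k)) \<omega> - Y ((1 / 2) ^ (n - k)) \<omega>) (?r ` {..<n})"
      unfolding img
      by (rule indep_vars_Y_increments[of "\<lambda>k. (1 / 2) ^ (n - k)"]) (auto intro!: power_decreasing)
    hence "indep_vars (\<lambda>_. borel)
        (\<lambda>j \<omega>. Y ((1 / 2) ^ (n - Suc (?r j))) \<omega> - Y ((1 / 2) ^ (n - ?r j)) \<omega>) {..<n}"
      by (rule indep_vars_reindex[rotated]) (auto simp: inj_on_def)
    thus ?thesis
      by (rule indep_vars_cong[THEN iffD1, rotated -1]) (auto simp: Suc_diff_Suc)
  qed
  show ?thesis unfolding indep_vars_def2
  proof (intro conjI ballI)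
    show "random_variable borel (?D n)" for n
      by (intro borel_measurable_diff random_variable_Y) auto
    show "indep_sets (\<lambda>i. {?D i -` A \<inter> space M |A. A \<in> sets borel}) UNIV"
    proof (subst indep_sets_finite_index_sets, intro allI impI)
      fix J :: "nat set" assume "finite J"
      then obtain n where "J \<subseteq> {..<n}"
        by (metis finite_nat_iff_bounded)
      from indep_vars_subset[OF fin this] show "indep_sets (\<lambda>i. {?D i -` A \<inter> space M |A. A \<in> sets borel}) J"
        by (simp add: indep_vars_def2)
    qed
  qed
qed

lemma Y_right_continuous:
  "AE \<omega> in M. \<forall>t\<ge>0. continuous (at_right t) (\<lambda>t. Y t \<omega>)"
  using cadlag_paths
proof eventually_elim
  case (elim \<omega>)
  show ?case
  proof safe
    fix t :: real assume "0 \<le> t"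
    hence "continuous (at_right t) (\<lambda>t. Z t \<omega>)" using elim by (simp add: cadlag_def)
    thus "continuous (at_right t) (\<lambda>t. Y t \<omega>)"
      unfolding Y_def continuous_within by (intro tendsto_intros)
  qed
qed

text \<open>
  Right continuity at \<open>0\<close> makes each \<open>Y ((1 / 2) ^ n)\<close> the sum of all earlier increments.
\<close>

lemma Y_halving_sums:
  "AE \<omega> in M. \<forall>n. (\<lambda>k. Y ((1 / 2) ^ (k + n)) \<omega> - Y ((1 / 2) ^ Suc (k + n)) \<omega>) sums Y ((1 / 2) ^ n) \<omega>"
  using Y_right_continuous
proof eventually_elim
  case (elim \<omega>)
  show ?case
  proof
    fix n
    have "((\<lambda>t. Y t \<omega>) \<longlongrightarrow> Y 0 \<omega>) (at_right 0)"
      using elim[rule_format, of 0] by (simp add: continuous_within)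
    moreover have "filterlim (\<lambda>k. (1 / 2 :: real) ^ (k + n)) (at_right 0) sequentially"
      by (intro tendsto_imp_filterlim_at_right LIMSEQ_ignore_initial_segment LIMSEQ_power_zero
          always_eventually) auto
    ultimately have "(\<lambda>k. Y ((1 / 2) ^ (k + n)) \<omega>) \<longlonglongrightarrow> Y 0 \<omega>" by (rule filterlim_compose)
    from telescope_sums'[OF this]
    show "(\<lambda>k. Y ((1 / 2) ^ (k + n)) \<omega> - Y ((1 / 2) ^ Suc (k + n)) \<omega>) sums Y ((1 / 2) ^ n) \<omega>"
      by simp
  qed
qed

definition dyadic_exceedance :: "real \<Rightarrow> real \<Rightarrow> 'a set" where
  "dyadic_exceedance T x =
     {\<omega>\<in>space M. \<exists>m k. k \<le> (2::nat) ^ m \<and> x < \<bar>Y (real k * T / 2 ^ m) \<omega>\<bar>}"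

context
  assumes \<alpha>: "0 < \<alpha>" "\<alpha> < 2"
begin

text \<open>
  If \<open>T * x powr - \<alpha>\<close> is small, each remaining increment up to time \<open>T\<close> stays below \<open>x\<close> with
  probability at least \<open>1/2\<close> and \<open>ottaviani\<close> applies; otherwise the right-hand side exceeds \<open>1\<close>.
\<close>

lemma Y_grid_maximal:
  assumes T: "0 < T" and x: "0 < x" and n: "0 < n"
  shows "prob {\<omega>\<in>space M. \<exists>k\<le>n. 2 * x < \<bar>Y (real k * T / real n) \<omega>\<bar>} \<le> 16 * (T * x powr - \<alpha>)"
proof (cases "8 * (T * x powr - \<alpha>) \<le> 1 / 2")
  case True
  define s where "s k = real k * T / real n" for k
  have s: "0 \<le> s k" "k \<le> n \<Longrightarrow> s k \<le> T" "s n = T" "s 0 = 0" "s k \<le> s (Suc k)" for k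
    using T n by (auto simp: s_def field_simps mult_right_mono)
  let ?X = "\<lambda>k \<omega>. Y (s (Suc k)) \<omega> - Y (s k) \<omega>"
  have ind: "indep_vars (\<lambda>_. borel) ?X {..<n}"
    using s by (intro indep_vars_Y_increments) auto
  have upto: "(\<Sum>i<k. ?X i \<omega>) = Y (s k) \<omega>" for k \<omega>
    by (subst sum_lessThan_telescope) (simp add: s)
  have "1 / 2 * prob {\<omega>\<in>space M. \<exists>k\<le>n. 2 * x < \<bar>\<Sum>i<k. ?X i \<omega>\<bar>}
      \<le> prob {\<omega>\<in>space M. x < \<bar>\<Sum>i<n. ?X i \<omega>\<bar>}"
  proof (rule ottaviani[OF ind])
    fix k assume k: "k \<le> n"
    have [measurable]: "random_variable borel (Y T)" "random_variable borel (Y (s k))"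
      using T s(1) by (auto intro: random_variable_Y)
    have sum: "(\<Sum>i=k..<n. ?X i \<omega>) = Y T \<omega> - Y (s k) \<omega>" for \<omega>
      using sum_Suc_diff'[OF k, of "\<lambda>i. Y (s i) \<omega>"] s(3) by simp
    have "prob {\<omega>\<in>space M. x \<le> \<bar>Y T \<omega> - Y (s k) \<omega>\<bar>} \<le> 8 * ((T - s k) * x powr - \<alpha>)"
      using s k x Y_increment_char[of "s k" "T - s k"] by (intro stable_tail_upper[OF _ \<alpha>]) auto
    also have "\<dots> \<le> 8 * (T * x powr - \<alpha>)"
      using s by (intro mult_left_mono mult_right_mono) auto
    finally have "prob {\<omega>\<in>space M. x \<le> \<bar>\<Sum>i=k..<n. ?X i \<omega>\<bar>} \<le> 1 / 2"
      using True unfolding sum by linarith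
    moreover have "1 - prob {\<omega>\<in>space M. x \<le> \<bar>\<Sum>i=k..<n. ?X i \<omega>\<bar>}
        = prob {\<omega>\<in>space M. \<not> x \<le> \<bar>\<Sum>i=k..<n. ?X i \<omega>\<bar>}"
      unfolding sum by (intro prob_neg[symmetric]) measurable
    moreover have "\<dots> \<le> prob {\<omega>\<in>space M. \<bar>\<Sum>i=k..<n. ?X i \<omega>\<bar> \<le> x}"
      unfolding sum by (intro finite_measure_mono) auto
    ultimately show "1 / 2 \<le> prob {\<omega>\<in>space M. \<bar>\<Sum>i=k..<n. ?X i \<omega>\<bar> \<le> x}" by linarith
  qed
  also have "\<dots> \<le> prob {\<omega>\<in>space M. x \<le> \<bar>Y (0 + T) \<omega> - Y 0 \<omega>\<bar>}"
    using T random_variable_Y[of T] unfolding upto by (intro finite_measure_mono) (auto simp: s, measurable)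
  also have "\<dots> \<le> 8 * (T * x powr - \<alpha>)"
    using T x
    by (intro stable_tail_upper[OF borel_measurable_diff \<alpha>] Y_increment_char random_variable_Y) auto
  finally show ?thesis unfolding upto by (simp add: s_def)
next
  case False
  thus ?thesis using prob_le_1[of "{\<omega>\<in>space M. \<exists>k\<le>n. 2 * x < \<bar>Y (real k * T / real n) \<omega>\<bar>}"]
    by linarith
qed

text \<open>
  The bound of \<open>Y_grid_maximal\<close> does not depend on the grid, so it passes to the union of the
  dyadic grids, which increase.
\<close>

lemma dyadic_exceedance:
  assumes T: "0 < T" and x: "0 < x"
  shows sets_dyadic_exceedance: "dyadic_exceedance T (2 * x) \<in> events"
    and prob_dyadic_exceedance: "prob (dyadic_exceedance T (2 * x)) \<le> 16 * (T * x powr - \<alpha>)"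
proof -
  define E where "E m = {\<omega>\<in>space M. \<exists>k\<le>2 ^ m. 2 * x < \<bar>Y (real k * T / 2 ^ m) \<omega>\<bar>}" for m :: nat
  have Y[measurable]: "random_variable borel (Y (real k * T / 2 ^ m))" for k m :: nat
    using T by (intro random_variable_Y) auto
  have E: "E m \<in> events" for m
    unfolding E_def by measurable
  have un: "dyadic_exceedance T (2 * x) = (\<Union>m. E m)"
    by (auto simp: dyadic_exceedance_def E_def)
  show "dyadic_exceedance T (2 * x) \<in> events" unfolding un using E by auto
  have "incseq E"
  proof (rule incseq_SucI, safe)
    fix m \<omega> assume "\<omega> \<in> E m"
    then obtain k where "\<omega> \<in> space M" "k \<le> 2 ^ m" "2 * x < \<bar>Y (real k * T / 2 ^ m) \<omega>\<bar>"
      by (auto simp: E_def)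
    thus "\<omega> \<in> E (Suc m)" unfolding E_def by (auto intro!: exI[of _ "2 * k"])
  qed
  hence "(\<lambda>m. prob (E m)) \<longlonglongrightarrow> prob (\<Union>m. E m)"
    using E by (intro finite_Lim_measure_incseq) auto
  moreover have "prob (E m) \<le> 16 * (T * x powr - \<alpha>)" for m
    using Y_grid_maximal[OF T x, of "2 ^ m"] by (simp add: E_def)
  ultimately show "prob (dyadic_exceedance T (2 * x)) \<le> 16 * (T * x powr - \<alpha>)"
    unfolding un by (intro LIMSEQ_le_const2) auto
qed

text \<open>
  The threshold on the block of times from \<open>(1 / 2) ^ Suc n\<close> to \<open>(1 / 2) ^ n\<close> is
  \<open>\<epsilon> * f ((1 / 2) ^ Suc n)\<close>, a lower bound for \<open>\<epsilon> * f\<close> there. The probabilities of exceeding it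
  sum up to a multiple of the given series.
\<close>

lemma Y_eventually_below:
  assumes f: "mono_on {0<..} f" "\<And>t. 0 < t \<Longrightarrow> 0 < f t"
    and sum: "summable (\<lambda>n. (1 / 2) ^ n * f ((1 / 2) ^ n) powr - \<alpha>)"
    and \<epsilon>: "0 < \<epsilon>"
  shows "AE \<omega> in M. eventually (\<lambda>t. \<bar>Y t \<omega>\<bar> \<le> \<epsilon> * f t) (at_right 0)"
proof -
  define x where "x n = \<epsilon> / 2 * f ((1 / 2) ^ Suc n)" for n
  have x: "0 < x n" for n using f(2) \<epsilon> by (simp add: x_def)
  define E where "E n = dyadic_exceedance ((1 / 2) ^ n) (2 * x n)" for n
  have "AE \<omega> in M. eventually (\<lambda>n. \<omega> \<in> space M - E n) sequentially"
  proof (rule borel_cantelli_AE1)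
    show "E n \<in> events" for n
      unfolding E_def using x by (intro sets_dyadic_exceedance) auto
    show "emeasure M (E n) < \<infinity>" for n by (simp add: emeasure_eq_measure)
    show "summable (\<lambda>n. prob (E n))"
    proof (rule summable_comparison_test')
      show "summable (\<lambda>n. 32 * (\<epsilon> / 2) powr - \<alpha> *
          ((1 / 2) ^ Suc n * f ((1 / 2) ^ Suc n) powr - \<alpha>))"
        by (intro summable_mult summable_Suc_iff[THEN iffD2] sum)
      fix n
      have "prob (E n) \<le> 16 * ((1 / 2) ^ n * x n powr - \<alpha>)"
        unfolding E_def using x by (intro prob_dyadic_exceedance) auto
      also have "\<dots> = 32 * (\<epsilon> / 2) powr - \<alpha> * ((1 / 2) ^ Suc n * f ((1 / 2) ^ Suc n) powr - \<alpha>)"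
        using \<epsilon> f(2)[of "(1 / 2) ^ Suc n"] unfolding x_def by (subst powr_mult) auto
      finally show "norm (prob (E n)) \<le> 32 * (\<epsilon> / 2) powr - \<alpha> *
          ((1 / 2) ^ Suc n * f ((1 / 2) ^ Suc n) powr - \<alpha>)" by simp
    qed
  qed
  with Y_right_continuous show ?thesis
  proof eventually_elim
    case (elim \<omega>)
    then obtain N where N: "\<And>n. N \<le> n \<Longrightarrow> \<omega> \<in> space M - E n"
      by (auto simp: eventually_sequentially)
    show "eventually (\<lambda>t. \<bar>Y t \<omega>\<bar> \<le> \<epsilon> * f t) (at_right 0)"
      unfolding eventually_at_right_field
    proof (intro exI[of _ "(1 / 2) ^ N"] conjI allI impI)
      fix t :: real assume "0 < t" "t < (1 / 2) ^ N"
      then obtain n where n: "N \<le> n" "(1 / 2) ^ Suc n < t" "t \<le> (1 / 2) ^ n"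
        using half_power_bracket[of t N] by auto
      have "\<bar>Y t \<omega>\<bar> \<le> 2 * x n"
      proof (rule abs_bound_from_dyadics[of t "\<lambda>t. Y t \<omega>"])
        show "\<bar>Y (real k * (1 / 2) ^ n / 2 ^ m) \<omega>\<bar> \<le> 2 * x n" if "k \<le> 2 ^ m" for k m
          using N[OF n(1)] that by (auto simp: E_def dyadic_exceedance_def not_less)
      qed (use elim(1) n \<open>0 < t\<close> in auto)
      also have "\<dots> = \<epsilon> * f ((1 / 2) ^ Suc n)" by (simp add: x_def)
      also have "\<dots> \<le> \<epsilon> * f t"
        using n \<epsilon> \<open>0 < t\<close> by (intro mult_left_mono mono_onD[OF f(1)]) auto
      finally show "\<bar>Y t \<omega>\<bar> \<le> \<epsilon> * f t" .
    qed simp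
  qed
qed

text \<open>
  The increments between consecutive times satisfy the hypotheses of
  \<open>tail_sum_exceeds_infinitely_often\<close>: their tail sums are the values \<open>Y ((1 / 2) ^ n)\<close>, which are
  nonnegative with probability at least \<open>1/2\<close>, and the lower tail bound makes the exceedance
  probabilities diverge.
\<close>

lemma Y_infinitely_often_above:
  fixes f :: "real \<Rightarrow> real"
  assumes f: "\<And>t. 0 < t \<Longrightarrow> 0 < f t"
    and div: "\<not> summable (\<lambda>n. (1 / 2) ^ n * f ((1 / 2) ^ n) powr - \<alpha>)"
    and K: "0 < K"
  shows "AE \<omega> in M. \<forall>N. \<exists>n\<ge>N. K * f ((1 / 2) ^ n) < Y ((1 / 2) ^ n) \<omega>"
proof -
  define D where "D n \<omega> = Y ((1 / 2) ^ n) \<omega> - Y ((1 / 2) ^ Suc n) \<omega>" for n \<omega>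
  have D[measurable]: "random_variable borel (D n)" for n
    unfolding D_def[abs_def] by (intro borel_measurable_diff random_variable_Y) auto
  have tail: "AE \<omega> in M. (\<Sum>k. D (k + n) \<omega>) = Y ((1 / 2) ^ n) \<omega>" for n
    using Y_halving_sums by eventually_elim (auto simp: D_def sums_iff)
  have Dchar: "expectation (\<lambda>\<omega>. iexp (v * D n \<omega>)) = complex_of_real (exp (- ((1 / 2) ^ Suc n) * \<bar>v\<bar> powr \<alpha>))" for v n
    using Y_increment_char[of "(1 / 2) ^ Suc n" "(1 / 2) ^ Suc n" v] by (simp add: D_def)
  have "AE \<omega> in M. \<forall>N. \<exists>n\<ge>N. K * f ((1 / 2) ^ n) < (\<Sum>k. D (k + n) \<omega>)"
  proof (rule tail_sum_exceeds_infinitely_often)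
    show "indep_vars (\<lambda>_. borel) D UNIV" unfolding D_def[abs_def] by (rule indep_vars_Y_halving)
    show "AE \<omega> in M. summable (\<lambda>n. D n \<omega>)"
      using Y_halving_sums by eventually_elim (drule spec[of _ 0], auto simp: D_def sums_iff)
    show "1 / 2 \<le> prob {\<omega>\<in>space M. 0 \<le> (\<Sum>k. D (k + n) \<omega>)}" for n
    proof -
      have Y: "random_variable borel (Y ((1 / 2) ^ n))" by (intro random_variable_Y) auto
      have "1 / 2 \<le> prob {\<omega>\<in>space M. 0 \<le> Y ((1 / 2) ^ n) \<omega>}"
        using Y_increment_char[of 0 "(1 / 2) ^ n"]
        by (intro stable_nonneg_prob[OF Y \<alpha>, of "(1 / 2) ^ n"]) auto
      also have "\<dots> = prob {\<omega>\<in>space M. 0 \<le> (\<Sum>k. D (k + n) \<omega>)}"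
        using Y tail[of n] by (intro finite_measure_eq_AE) (auto elim: eventually_mono)
      finally show ?thesis .
    qed
    show "\<not> summable (\<lambda>n. prob {\<omega>\<in>space M. K * f ((1 / 2) ^ n) < D n \<omega>})"
    proof
      assume s: "summable (\<lambda>n. prob {\<omega>\<in>space M. K * f ((1 / 2) ^ n) < D n \<omega>})"
      define c where "c = 8 powr (- \<alpha> / (2 - \<alpha>)) / (16::real)"
      have c: "0 < c" by (simp add: c_def)
      define b where "b = K powr - \<alpha> / 2"
      have b: "0 < b" using K by (simp add: b_def)
      let ?q = "\<lambda>n. (1 / 2) ^ n * f ((1 / 2) ^ n) powr - \<alpha>"
      have "c * min 1 (b * ?q n) \<le> prob {\<omega>\<in>space M. K * f ((1 / 2) ^ n) < D n \<omega>}" for n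
      proof -
        have "0 < f ((1 / 2) ^ n)" using f by simp
        hence e: "b * ?q n = (1 / 2) ^ Suc n * (K * f ((1 / 2) ^ n)) powr - \<alpha>"
          using K by (simp add: b_def powr_mult)
        show ?thesis unfolding e c_def
          using K \<open>0 < f ((1 / 2) ^ n)\<close> by (intro stable_tail_lower[OF D \<alpha>] Dchar) auto
      qed
      hence "summable (\<lambda>n. c * min 1 (b * ?q n))"
        using b c by (intro summable_comparison_test'[OF s, of 0]) (simp add: abs_mult)
      hence sm: "summable (\<lambda>n. min 1 (b * ?q n))"
        using c by (simp add: summable_cmult_iff)
      \<comment> \<open>The truncation at \<open>1\<close> is eventually inactive, since the terms of a convergent series tend to \<open>0\<close>.\<close>
      hence "eventually (\<lambda>n. min 1 (b * ?q n) < 1) sequentially"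
        by (intro order_tendstoD[OF summable_LIMSEQ_zero]) auto
      hence "eventually (\<lambda>n. min 1 (b * ?q n) = b * ?q n) sequentially"
        by eventually_elim auto
      with sm have "summable (\<lambda>n. b * ?q n)" by (simp add: summable_cong)
      thus False using b div by (simp add: summable_cmult_iff)
    qed
  qed simp
  moreover have "AE \<omega> in M. \<forall>n. (\<Sum>k. D (k + n) \<omega>) = Y ((1 / 2) ^ n) \<omega>"
    using tail by (simp add: AE_all_countable)
  ultimately show ?thesis by eventually_elim simp
qed

end
end

section \<open>The winding angle at small times\<close>

text \<open>
  For small \<open>t\<close> the angle \<open>\<theta> t\<close> lies in \<open>{-1<..<1}\<close> by right continuity, where \<open>cos (\<theta> t) \<ge> 1/2\<close>
  and \<open>\<bar>sin (\<theta> t)\<bar> \<le> \<bar>\<theta> t\<bar> \<le> \<bar>tan (\<theta> t)\<bar>\<close>, while \<open>norm (z t)\<close> lies between \<open>1/2\<close> and \<open>2\<close>.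
\<close>

lemma winding_near_start:
  assumes w: "winding_of z \<theta>" and z: "cadlag z" "z 0 = 1"
  shows "eventually (\<lambda>t. \<bar>\<theta> t\<bar> \<le> 4 * \<bar>Im (z t)\<bar> \<and> (0 < Im (z t) \<longrightarrow> Im (z t) \<le> 2 * \<theta> t)) (at_right 0)"
proof -
  have "continuous (at_right 0) \<theta>" using w by (simp add: winding_of_def cadlag_def)
  hence "(\<theta> \<longlongrightarrow> \<theta> 0) (at_right 0)" by (simp add: continuous_within)
  hence "((\<lambda>t. \<bar>\<theta> t\<bar>) \<longlongrightarrow> 0) (at_right 0)"
    using w by (intro tendsto_rabs_zero) (simp add: winding_of_def)
  hence e1: "eventually (\<lambda>t. \<bar>\<theta> t\<bar> < 1) (at_right 0)"
    by (rule order_tendstoD) simp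
  have "(z \<longlongrightarrow> 1) (at_right 0)"
    using z by (auto simp: cadlag_def continuous_within)
  hence n: "((\<lambda>t. norm (z t)) \<longlongrightarrow> norm (1::complex)) (at_right 0)" by (rule tendsto_norm)
  have e2: "eventually (\<lambda>t. 1 / 2 < norm (z t)) (at_right 0)" using n by (rule order_tendstoD) simp
  have e3: "eventually (\<lambda>t. norm (z t) < 2) (at_right 0)" using n by (rule order_tendstoD) simp
  have e4: "eventually (\<lambda>t::real. 0 < t) (at_right 0)" by (rule eventually_at_right_less)
  show ?thesis using e1 e2 e3 e4
  proof eventually_elim
    case (elim t)
    have sin: "norm (z t) * sin (\<theta> t) = Im (z t)"
    proof -
      have "sin (\<theta> t) = Im (iexp (\<theta> t))" by (simp add: Im_exp)
      also have "iexp (\<theta> t) = z t / complex_of_real (norm (z t))"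
        using w elim by (simp add: winding_of_def)
      finally show ?thesis using elim by auto
    qed
    have "\<bar>\<theta> t\<bar> \<le> 2 * \<bar>sin (\<theta> t)\<bar>"
    proof -
      have "(\<theta> t)\<^sup>2 \<le> 1" using elim by (simp add: abs_square_le_1)
      hence c: "1 / 2 \<le> cos (\<theta> t)" using one_minus_cos_le[of "\<theta> t"] by linarith
      have "\<bar>\<theta> t\<bar> \<le> \<bar>tan (\<theta> t)\<bar>" using elim pi_gt3 by (intro abs_tan_ge) simp
      also have "\<dots> = \<bar>sin (\<theta> t)\<bar> / cos (\<theta> t)" using c by (simp add: tan_def)
      also have "\<dots> \<le> \<bar>sin (\<theta> t)\<bar> / (1 / 2)" using c by (intro divide_left_mono) auto
      finally show ?thesis by simp
    qed
    moreover have "1 / 2 * \<bar>sin (\<theta> t)\<bar> \<le> norm (z t) * \<bar>sin (\<theta> t)\<bar>"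
      using elim by (intro mult_right_mono) auto
    moreover have "norm (z t) * \<bar>sin (\<theta> t)\<bar> = \<bar>Im (z t)\<bar>"
      unfolding sin[symmetric] by (simp add: abs_mult)
    ultimately have "\<bar>\<theta> t\<bar> \<le> 4 * \<bar>Im (z t)\<bar>" by linarith
    moreover have "Im (z t) \<le> 2 * \<theta> t" if "0 < Im (z t)"
    proof -
      have "0 < sin (\<theta> t)" using that unfolding sin[symmetric] by (simp add: zero_less_mult_iff)
      moreover from this have "0 < \<theta> t"
        using elim pi_gt3 sin_ge_zero[of "- \<theta> t"] by (cases "0 < \<theta> t") auto
      hence "sin (\<theta> t) \<le> \<theta> t" by (intro sin_x_le_x) simp
      ultimately have "norm (z t) * sin (\<theta> t) \<le> 2 * \<theta> t"
        using elim by (intro mult_mono) auto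
      thus ?thesis by (simp add: sin)
    qed
    ultimately show ?case by simp
  qed
qed

lemma Limsup_ratio_eq_0:
  fixes u f :: "real \<Rightarrow> real"
  assumes f: "\<And>t. 0 < t \<Longrightarrow> 0 < f t"
    and small: "\<And>k::nat. eventually (\<lambda>t. \<bar>u t\<bar> \<le> C * (1 / real (Suc k) * f t)) (at_right 0)"
  shows "Limsup (at_right 0) (\<lambda>t. ereal (u t / f t)) = 0"
proof (rule lim_imp_Limsup)
  have "((\<lambda>t. u t / f t) \<longlongrightarrow> 0) (at_right 0)"
  proof (rule tendstoI)
    fix e :: real assume "0 < e"
    obtain k where "\<bar>C\<bar> / e < real k" using reals_Archimedean2 by blast
    hence "\<bar>C\<bar> / e < real (Suc k)" by simp
    hence k: "\<bar>C\<bar> / real (Suc k) < e" using \<open>0 < e\<close> by (simp only: divide_less_eq) (simp add: mult.commute)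
    have pos: "eventually (\<lambda>t::real. 0 < t) (at_right 0)" by (rule eventually_at_right_less)
    show "eventually (\<lambda>t. dist (u t / f t) 0 < e) (at_right 0)"
      using small[of k] pos
    proof eventually_elim
      case (elim t)
      have "0 < f t" using f elim by simp
      hence "\<bar>u t\<bar> / f t \<le> C / real (Suc k)" using elim(1) by (simp add: pos_divide_le_eq)
      also have "\<dots> \<le> \<bar>C\<bar> / real (Suc k)" by (intro divide_right_mono) auto
      finally show ?case using k \<open>0 < f t\<close> by simp
    qed
  qed
  thus "((\<lambda>t. ereal (u t / f t)) \<longlongrightarrow> 0) (at_right 0)"
    by (simp add: zero_ereal_def)
qed simp

lemma Limsup_ratio_eq_infinity:
  fixes u f :: "real \<Rightarrow> real"
  assumes s: "filterlim s (at_right 0) sequentially" and f: "\<And>t. 0 < t \<Longrightarrow> 0 < f t"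
    and large: "\<And>k::nat. \<exists>\<^sub>F n in sequentially. real k * f (s n) \<le> u (s n)"
  shows "Limsup (at_right 0) (\<lambda>t. ereal (u t / f t)) = \<infinity>"
proof (rule ereal_top, rule ccontr)
  fix B assume "\<not> ereal B \<le> Limsup (at_right 0) (\<lambda>t. ereal (u t / f t))"
  hence "eventually (\<lambda>t. ereal (u t / f t) < ereal B) (at_right 0)"
    by (intro Limsup_lessD) simp
  hence "eventually (\<lambda>t. u t / f t < B \<and> 0 < t) (at_right 0)"
    by (intro eventually_conj eventually_at_right_less) simp
  hence ev: "eventually (\<lambda>n. u (s n) / f (s n) < B \<and> 0 < s n) sequentially"
    using s by (rule eventually_compose_filterlim)
  obtain k where "B \<le> real k" using real_arch_simple by blast
  have "\<exists>\<^sub>F n in sequentially. False"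
    using frequently_eventually_conj[OF large[of k] ev]
  proof (rule frequently_elim1)
    fix n assume *: "(u (s n) / f (s n) < B \<and> 0 < s n) \<and> real k * f (s n) \<le> u (s n)"
    hence "real k \<le> u (s n) / f (s n)" using f[of "s n"] by (simp add: pos_le_divide_eq)
    thus False using * \<open>B \<le> real k\<close> by simp
  qed
  thus False by simp
qed

theorem theorem5p4:
  fixes M :: "'a measure" and \<alpha> :: real
    and Z :: "real \<Rightarrow> 'a \<Rightarrow> complex" and \<theta> :: "real \<Rightarrow> 'a \<Rightarrow> real"
    and f :: "real \<Rightarrow> real"
  assumes "0 < \<alpha>" and "\<alpha> < 2"
    and "isotropic_stable_process M \<alpha> Z"
    and "AE \<omega> in M. winding_of (\<lambda>t. Z t \<omega>) (\<lambda>t. \<theta> t \<omega>)"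
    and "mono_on {0<..} f" and "\<And>t. t > 0 \<Longrightarrow> f t > 0"
  shows "((AE \<omega> in M. Limsup (at_right 0) (\<lambda>t. ereal (\<theta> t \<omega> / f t)) = 0) \<longleftrightarrow>
           (\<integral>\<^sup>+ t\<in>{0<..1}. ennreal (f t powr (- \<alpha>)) \<partial>lborel) < \<infinity>)
       \<and> ((AE \<omega> in M. Limsup (at_right 0) (\<lambda>t. ereal (\<theta> t \<omega> / f t)) = \<infinity>) \<longleftrightarrow>
           (\<integral>\<^sup>+ t\<in>{0<..1}. ennreal (f t powr (- \<alpha>)) \<partial>lborel) = \<infinity>)"
proof -
  interpret isotropic_stable_process M \<alpha> Z by fact
  let ?L = "\<lambda>\<omega>. Limsup (at_right 0) (\<lambda>t. ereal (\<theta> t \<omega> / f t))"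
  let ?I = "\<integral>\<^sup>+ t\<in>{0<..1}. ennreal (f t powr (- \<alpha>)) \<partial>lborel"
  let ?q = "\<lambda>n. (1 / 2) ^ n * f ((1 / 2) ^ n) powr - \<alpha>"
  have I: "?I < \<infinity> \<longleftrightarrow> summable ?q"
    using assms(1,6) by (intro integral_test_halving powr_mono2' mono_onD[OF assms(5)]) auto
  have near: "AE \<omega> in M. eventually (\<lambda>t. \<bar>\<theta> t \<omega>\<bar> \<le> 4 * \<bar>Y t \<omega>\<bar> \<and> (0 < Y t \<omega> \<longrightarrow> Y t \<omega> \<le> 2 * \<theta> t \<omega>)) (at_right 0)"
    using assms(4) cadlag_paths start
  proof eventually_elim
    case (elim \<omega>)
    from winding_near_start[OF this] elim(3) show ?case by (simp add: Y_def)
  qed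
  have zero: "AE \<omega> in M. ?L \<omega> = 0" if "?I < \<infinity>"
  proof -
    have sum: "summable ?q" using that by (simp only: I)
    have "AE \<omega> in M. \<forall>k::nat. eventually (\<lambda>t. \<bar>Y t \<omega>\<bar> \<le> 1 / real (Suc k) * f t) (at_right 0)"
      unfolding AE_all_countable using sum assms by (intro allI Y_eventually_below) auto
    with near show ?thesis
    proof eventually_elim
      case (elim \<omega>)
      show ?case
      proof (rule Limsup_ratio_eq_0[where C = 4])
        fix k
        show "eventually (\<lambda>t. \<bar>\<theta> t \<omega>\<bar> \<le> 4 * (1 / real (Suc k) * f t)) (at_right 0)"
          using elim(1) elim(2)[rule_format, of k] by eventually_elim linarith
      qed fact
    qed
  qed
  have inf: "AE \<omega> in M. ?L \<omega> = \<infinity>" if "\<not> ?I < \<infinity>"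
  proof -
    have div: "\<not> summable ?q" using that I by blast
    \<comment> \<open>The factor \<open>2\<close> absorbs the loss in \<open>Y t \<le> 2 * \<theta> t\<close>,
      and \<open>Suc k\<close> keeps the multiple positive.\<close>
    have "AE \<omega> in M. \<forall>k::nat. \<forall>N. \<exists>n\<ge>N. real (2 * Suc k) * f ((1 / 2) ^ n) < Y ((1 / 2) ^ n) \<omega>"
      by (subst AE_all_countable, intro allI Y_infinitely_often_above) (use div assms in auto)
    with near show ?thesis
    proof eventually_elim
      case (elim \<omega>)
      have s: "filterlim (\<lambda>n. (1 / 2 :: real) ^ n) (at_right 0) sequentially"
        by (intro tendsto_imp_filterlim_at_right LIMSEQ_power_zero always_eventually) auto
      show ?case
      proof (rule Limsup_ratio_eq_infinity[OF s])
        fix k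
        have "\<exists>\<^sub>F n in sequentially. real (2 * Suc k) * f ((1 / 2) ^ n) < Y ((1 / 2) ^ n) \<omega>"
          using elim(2) by (auto simp: frequently_sequentially)
        moreover have "eventually (\<lambda>n. 0 < Y ((1 / 2) ^ n) \<omega> \<longrightarrow> Y ((1 / 2) ^ n) \<omega> \<le> 2 * \<theta> ((1 / 2) ^ n) \<omega>) sequentially"
          using elim(1) s by (auto simp: filterlim_iff elim: eventually_mono)
        ultimately show "\<exists>\<^sub>F n in sequentially. real k * f ((1 / 2) ^ n) \<le> \<theta> ((1 / 2) ^ n) \<omega>"
        proof (rule frequently_eventually_conj[THEN frequently_elim1])
          fix n assume *: "(0 < Y ((1 / 2) ^ n) \<omega> \<longrightarrow> Y ((1 / 2) ^ n) \<omega> \<le> 2 * \<theta> ((1 / 2) ^ n) \<omega>) \<and>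
            real (2 * Suc k) * f ((1 / 2) ^ n) < Y ((1 / 2) ^ n) \<omega>"
          have f: "0 < f ((1 / 2) ^ n)" using assms(6) by simp
          hence "0 < real (2 * Suc k) * f ((1 / 2) ^ n)" by simp
          with * have "real (2 * Suc k) * f ((1 / 2) ^ n) \<le> 2 * \<theta> ((1 / 2) ^ n) \<omega>" by linarith
          with f show "real k * f ((1 / 2) ^ n) \<le> \<theta> ((1 / 2) ^ n) \<omega>" by (simp add: algebra_simps)
        qed
      qed fact
    qed
  qed
  have excl: False if "AE \<omega> in M. ?L \<omega> = 0" "AE \<omega> in M. ?L \<omega> = \<infinity>"
  proof -
    have "AE \<omega> in M. False" using that by eventually_elim simp
    thus False by simp
  qed
  have I_inf: "?I = \<infinity> \<longleftrightarrow> \<not> ?I < \<infinity>" by (simp add: less_top[symmetric])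
  have "(P \<longleftrightarrow> R) \<and> (Q \<longleftrightarrow> S)"
    if "R \<Longrightarrow> P" "\<not> R \<Longrightarrow> Q" "P \<Longrightarrow> Q \<Longrightarrow> False" "S \<longleftrightarrow> \<not> R" for P Q R S
    using that by blast
  from this[OF zero inf excl I_inf] show ?thesis .
qed

end
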